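(* Let $M$ be a Riemann surface, let $F:M\to S^6$ be an almost complex map and let $\alpha$ be a holomorphic line subbundle of $F^{-1}T^{1,0}S^6$. Set $$\varphi=\overline\alpha\oplus\mathrm{span}\{F\}\oplus\alpha.$$ Then $\varphi$ is a nilconformal harmonic map from $M$ to $G_2/\mathrm{SO}(4)$.
   Context: $\mathbb{O}$ is the algebra of octonions, $\mathrm{Im}\,\mathbb{O}\cong\mathbb{R}^7$ its imaginary part with the standard Euclidean inner product $(\cdot,\cdot)$ and vector product $v\times w=$ imaginary part of $v\cdot w$; both are extended complex-bilinearly to $\mathbb{C}^7=\mathrm{Im}\,\mathbb{O}\otimes\mathbb{C}$; orthogonality in $\mathbb{C}^7$ is with respect to the Hermitian inner product $(v,\overline w)$. A real 3-dimensional subspace of $\mathrm{Im}\,\mathbb{O}$ is associative if it is the imaginary part of a subalgebra isomorphic to the quaternions; $G_2/\mathrm{SO}(4)$, $G_2=\mathrm{Aut}(\mathbb{O})$, is the symmetric space of all associative 3-dimensional subspaces (identified with their complexifications). A Riemann surface is a connected (not necessarily compact) one-dimensional complex manifold. $S^6$ is the unit sphere in $\mathrm{Im}\,\mathbb{O}$, with almost complex structure $J_Fv=F\times v$ ($v\in T_FS^6=\{F\}^\perp$). Its $(1,0)$-space is $T^{1,0}_FS^6=\{v\in\mathbb{C}^7: v\perp F,\ F\times v=\mathrm i v\}$. A smooth map $F:M\to S^6$ is almost complex if its differential intertwines the complex structure of $M$ with $J$. Write $f=\mathrm{span}\{F\}$, a line subbundle of $M\times\mathbb{C}^7$. The bundle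 $f^\perp\subset M\times\mathbb{C}^7$ has the holomorphic structure with $\bar\partial$-operator $v\mapsto\pi_{f^\perp}(\partial_{\bar z}v)$ ($z$ a local complex coordinate, $\pi_{f^\perp}$ orthogonal projection); $F^{-1}T^{1,0}S^6$ is regarded as a holomorphic subbundle of $f^\perp$, and a line subbundle $\alpha$ of it is holomorphic if its sections are closed under this operator. A map $\varphi:M\to G_2/\mathrm{SO}(4)$ is identified with a rank 3 subbundle $\varphi$ of $M\times\mathbb{C}^7$, and with the map $\iota=\pi_\varphi-\pi_{\varphi^\perp}$ into $\mathrm U(7)$; $A^\varphi_z=\frac12\iota^{-1}\partial_z\iota$. $\varphi$ is nilconformal if, on each coordinate domain, $(A^\varphi_z)^r=0$ for some $r\in\mathbb{N}$. *)

theory Defs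
  imports "HOL-Analysis.Analysis"
begin

section \<open>Quaternions, octonions and the vector product\<close>

text \<open>
  Quaternions are pairs of complex numbers, \<open>(a, b)\<close> standing for \<open>a + b j\<close>; octonions are
  pairs of quaternions with the Cayley-Dickson product. The product-type instances supply the real
  vector space structure and the standard Euclidean inner product.
\<close>

type_synonym quat = "complex \<times> complex"
type_synonym octo = "quat \<times> quat"

definition quat_mult :: "quat \<Rightarrow> quat \<Rightarrow> quat"
  where "quat_mult p q =
    (fst p * fst q - snd p * cnj (snd q), fst p * snd q + snd p * cnj (fst q))"

definition quat_cnj :: "quat \<Rightarrow> quat"
  where "quat_cnj p = (cnj (fst p), - snd p)"

definition octo_mult :: "octo \<Rightarrow> octo \<Rightarrow> octo"
  where "octo_mult x y =
    (quat_mult (fst x) (fst y) - quat_mult (quat_cnj (snd y)) (snd x),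
     quat_mult (snd y) (fst x) + quat_mult (snd x) (quat_cnj (fst y)))"

lemma norm_octo_mult: "norm (octo_mult x y) = norm x * norm y"
proof -
  have norm_octo: "(norm v)\<^sup>2 =
      (Re (fst (fst v)))\<^sup>2 + (Im (fst (fst v)))\<^sup>2 + (Re (snd (fst v)))\<^sup>2 + (Im (snd (fst v)))\<^sup>2 +
      (Re (fst (snd v)))\<^sup>2 + (Im (fst (snd v)))\<^sup>2 + (Re (snd (snd v)))\<^sup>2 + (Im (snd (snd v)))\<^sup>2"
    for v :: octo
    by (simp add: norm_prod_def cmod_power2)
  have "(norm (octo_mult x y))\<^sup>2 = (norm x * norm y)\<^sup>2"
    unfolding power_mult_distrib norm_octo
    by (simp add: octo_mult_def quat_mult_def quat_cnj_def) algebra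
  then show ?thesis
    by (simp add: power2_eq_iff_nonneg)
qed

text \<open>The identification of the imaginary octonions with \<open>real^7\<close>, and the imaginary part.\<close>

definition imag_octo :: "real^7 \<Rightarrow> octo"
  where "imag_octo x =
    ((Complex 0 (x$1), Complex (x$2) (x$3)), (Complex (x$4) (x$5), Complex (x$6) (x$7)))"

definition octo_Im :: "octo \<Rightarrow> real^7"
  where "octo_Im x = vector
    [Im (fst (fst x)), Re (snd (fst x)), Im (snd (fst x)),
     Re (fst (snd x)), Im (fst (snd x)), Re (snd (snd x)), Im (snd (snd x))]"

definition cross7 :: "real^7 \<Rightarrow> real^7 \<Rightarrow> real^7"
  where "cross7 v w = octo_Im (octo_mult (imag_octo v) (imag_octo w))"

section \<open>Complexification\<close>

definition cvec :: "real^'n \<Rightarrow> complex^'n"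
  where "cvec x = (\<chi> i. complex_of_real (x$i))"

definition Re_vec :: "complex^'n \<Rightarrow> real^'n"
  where "Re_vec v = (\<chi> i. Re (v$i))"

definition Im_vec :: "complex^'n \<Rightarrow> real^'n"
  where "Im_vec v = (\<chi> i. Im (v$i))"

definition cnj_vec :: "complex^'n \<Rightarrow> complex^'n"
  where "cnj_vec v = (\<chi> i. cnj (v$i))"

definition ccross7 :: "complex^7 \<Rightarrow> complex^7 \<Rightarrow> complex^7"
  where "ccross7 v w =
    cvec (cross7 (Re_vec v) (Re_vec w) - cross7 (Im_vec v) (Im_vec w)) +
    \<i> *s cvec (cross7 (Re_vec v) (Im_vec w) + cross7 (Im_vec v) (Re_vec w))"

definition hermitian :: "complex^'n \<Rightarrow> complex^'n \<Rightarrow> complex"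
  where "hermitian v w = (\<Sum>i\<in>UNIV. v$i * cnj (w$i))"

definition hperp :: "(complex^'n) set \<Rightarrow> (complex^'n) set"
  where "hperp W = {v. \<forall>w\<in>W. hermitian v w = 0}"

definition hproj :: "(complex^'n) set \<Rightarrow> complex^'n \<Rightarrow> complex^'n"
  where "hproj W v = (THE w. w \<in> W \<and> v - w \<in> hperp W)"

definition complexification :: "(real^'n) set \<Rightarrow> (complex^'n) set"
  where "complexification W = {cvec a + \<i> *s cvec b | a b. a \<in> W \<and> b \<in> W}"

section \<open>Associative subspaces\<close>

definition quaternion_subalgebra :: "octo set \<Rightarrow> bool"
  where "quaternion_subalgebra H \<longleftrightarrow>
    subspace H \<and> (\<forall>x\<in>H. \<forall>y\<in>H. octo_mult x y \<in> H) \<and>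
    (\<exists>h. linear h \<and> bij_betw h UNIV H \<and>
         (\<forall>p q. h (quat_mult p q) = octo_mult (h p) (h q)))"

definition associative_subspace :: "(real^7) set \<Rightarrow> bool"
  where "associative_subspace W \<longleftrightarrow>
    subspace W \<and> dim W = 3 \<and> (\<exists>H. quaternion_subalgebra H \<and> W = octo_Im ` H)"

definition G2_SO4 :: "(complex^7) set set"
  where "G2_SO4 = complexification ` {W. associative_subspace W}"

definition iota :: "(complex^'n) set \<Rightarrow> complex^'n^'n"
  where "iota W = matrix (hproj W) - matrix (hproj (hperp W))"

section \<open>Riemann surfaces and smooth maps\<close>

primrec Ck_on :: "nat \<Rightarrow> 'a::real_normed_vector set \<Rightarrow> ('a \<Rightarrow> 'b::real_normed_vector) \<Rightarrow> bool"
  where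
    "Ck_on 0 S f \<longleftrightarrow> continuous_on S f"
  | "Ck_on (Suc k) S f \<longleftrightarrow>
      (\<forall>x\<in>S. f differentiable (at x)) \<and>
      (\<forall>v. Ck_on k S (\<lambda>x. frechet_derivative f (at x) v))"

text \<open>Only used for open \<open>S\<close>.\<close>

definition smooth_on :: "'a::real_normed_vector set \<Rightarrow> ('a \<Rightarrow> 'b::real_normed_vector) \<Rightarrow> bool"
  where "smooth_on S f \<longleftrightarrow> (\<forall>k. Ck_on k S f)"

text \<open>
  The surface is a subset \<open>M\<close> of a Hausdorff space with the subspace topology, equipped with a
  holomorphic atlas, which need not be maximal. Second countability is not assumed.
\<close>

type_synonym 'm atlas = "('m set \<times> ('m \<Rightarrow> complex)) set"

definition riemann_surface :: "'m::t2_space set \<Rightarrow> 'm atlas \<Rightarrow> bool"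
  where "riemann_surface M \<A> \<longleftrightarrow>
    connected M \<and>
    (\<forall>(U, z)\<in>\<A>. openin (top_of_set M) U \<and> open (z ` U) \<and>
                 homeomorphism U (z ` U) z (inv_into U z)) \<and>
    (\<Union>(U, z)\<in>\<A>. U) = M \<and>
    (\<forall>(U, z)\<in>\<A>. \<forall>(V, w)\<in>\<A>. (w \<circ> inv_into U z) holomorphic_on z ` (U \<inter> V))"

definition smooth_map_on :: "'m atlas \<Rightarrow> 'm set \<Rightarrow> ('m \<Rightarrow> 'b::real_normed_vector) \<Rightarrow> bool"
  where "smooth_map_on \<A> V f \<longleftrightarrow>
    (\<forall>(U, z)\<in>\<A>. smooth_on (z ` (U \<inter> V)) (f \<circ> inv_into U z))"

text \<open>The directional derivative at \<open>p\<close>, in the chart \<open>(U, z)\<close>, along the tangent vector that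
  the chart maps to \<open>h\<close>.\<close>

definition chart_deriv ::
    "'m set \<Rightarrow> ('m \<Rightarrow> complex) \<Rightarrow> complex \<Rightarrow> ('m \<Rightarrow> 'b::real_normed_vector) \<Rightarrow> 'm \<Rightarrow> 'b"
  where "chart_deriv U z h f p = frechet_derivative (f \<circ> inv_into U z) (at (z p)) h"

definition d_z :: "'m set \<Rightarrow> ('m \<Rightarrow> complex) \<Rightarrow> ('m \<Rightarrow> complex) \<Rightarrow> 'm \<Rightarrow> complex"
  where "d_z U z f p = (chart_deriv U z 1 f p - \<i> * chart_deriv U z \<i> f p) / 2"

definition d_zbar :: "'m set \<Rightarrow> ('m \<Rightarrow> complex) \<Rightarrow> ('m \<Rightarrow> complex) \<Rightarrow> 'm \<Rightarrow> complex"
  where "d_zbar U z f p = (chart_deriv U z 1 f p + \<i> * chart_deriv U z \<i> f p) / 2"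

definition d_zbar_vec :: "'m set \<Rightarrow> ('m \<Rightarrow> complex) \<Rightarrow> ('m \<Rightarrow> complex^'n) \<Rightarrow> 'm \<Rightarrow> complex^'n"
  where "d_zbar_vec U z s p = (\<chi> i. d_zbar U z (\<lambda>q. s q $ i) p)"

definition d_z_mat ::
    "'m set \<Rightarrow> ('m \<Rightarrow> complex) \<Rightarrow> ('m \<Rightarrow> complex^'n^'k) \<Rightarrow> 'm \<Rightarrow> complex^'n^'k"
  where "d_z_mat U z B p = (\<chi> i j. d_z U z (\<lambda>q. B q $ i $ j) p)"

section \<open>Almost complex maps and holomorphic line subbundles\<close>

definition almost_complex_map :: "'m::t2_space set \<Rightarrow> 'm atlas \<Rightarrow> ('m \<Rightarrow> real^7) \<Rightarrow> bool"
  where "almost_complex_map M \<A> F \<longleftrightarrow>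
    (\<forall>p\<in>M. F p \<in> sphere 0 1) \<and> smooth_map_on \<A> M F \<and>
    (\<forall>(U, z)\<in>\<A>. \<forall>p\<in>U. \<forall>h.
       chart_deriv U z (\<i> * h) F p = cross7 (F p) (chart_deriv U z h F p))"

definition T10_S6 :: "real^7 \<Rightarrow> (complex^7) set"
  where "T10_S6 x = {v. hermitian v (cvec x) = 0 \<and> ccross7 (cvec x) v = \<i> *s v}"

definition line_subbundle ::
    "'m::t2_space set \<Rightarrow> 'm atlas \<Rightarrow> ('m \<Rightarrow> (complex^'n) set) \<Rightarrow> bool"
  where "line_subbundle M \<A> L \<longleftrightarrow>
    (\<forall>p\<in>M. \<exists>V s. openin (top_of_set M) V \<and> p \<in> V \<and> smooth_map_on \<A> V s \<and>
                 (\<forall>q\<in>V. s q \<noteq> 0 \<and> L q = vec.span {s q}))"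

definition holomorphic_line_subbundle_T10 ::
    "'m::t2_space set \<Rightarrow> 'm atlas \<Rightarrow> ('m \<Rightarrow> real^7) \<Rightarrow> ('m \<Rightarrow> (complex^7) set) \<Rightarrow> bool"
  where "holomorphic_line_subbundle_T10 M \<A> F \<alpha> \<longleftrightarrow>
    line_subbundle M \<A> \<alpha> \<and> (\<forall>p\<in>M. \<alpha> p \<subseteq> T10_S6 (F p)) \<and>
    (\<forall>V s. openin (top_of_set M) V \<and> smooth_map_on \<A> V s \<and> (\<forall>q\<in>V. s q \<in> \<alpha> q) \<longrightarrow>
       (\<forall>(U, z)\<in>\<A>. \<forall>p\<in>U \<inter> V.
          hproj (hperp (vec.span {cvec (F p)})) (d_zbar_vec U z s p) \<in> \<alpha> p))"

section \<open>Harmonic and nilconformal maps\<close>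

definition tangent_vectors :: "'a::euclidean_space set \<Rightarrow> 'a \<Rightarrow> 'a set"
  where "tangent_vectors N x =
    {v. \<exists>\<gamma> e. e > 0 \<and> smooth_on {-e<..<e} \<gamma> \<and> \<gamma> ` {-e<..<e} \<subseteq> N \<and> \<gamma> 0 = x \<and>
              (\<gamma> has_vector_derivative v) (at (0::real))}"

definition chart_laplacian ::
    "'m set \<Rightarrow> ('m \<Rightarrow> complex) \<Rightarrow> ('m \<Rightarrow> 'b::real_normed_vector) \<Rightarrow> 'm \<Rightarrow> 'b"
  where "chart_laplacian U z u p =
    chart_deriv U z 1 (chart_deriv U z 1 u) p + chart_deriv U z \<i> (chart_deriv U z \<i> u) p"

text \<open>
  Harmonic maps into a submanifold \<open>N\<close> of a Euclidean space with the induced metric. The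
  Levi-Civita connection of \<open>N\<close> is the tangential part of the flat connection, so up to a positive
  conformal factor the tension field \<open>trace (\<nabla> du)\<close> is the tangential part of the Laplacian of
  \<open>u\<close> in a holomorphic coordinate; the map is harmonic if the tension field vanishes.
\<close>

definition harmonic_map ::
    "'m::t2_space set \<Rightarrow> 'm atlas \<Rightarrow> 'b::euclidean_space set \<Rightarrow> ('m \<Rightarrow> 'b) \<Rightarrow> bool"
  where "harmonic_map M \<A> N u \<longleftrightarrow>
    (\<forall>p\<in>M. u p \<in> N) \<and> smooth_map_on \<A> M u \<and>
    (\<forall>(U, z)\<in>\<A>. \<forall>p\<in>U. \<forall>v\<in>tangent_vectors N (u p). inner (chart_laplacian U z u p) v = 0)"

text \<open>
  The map \<open>iota\<close> embeds the space of associative subspaces as a single orbit of \<open>G\<^sub>2\<close> acting by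
  conjugation on matrices, for which the real inner product of \<open>complex^7^7\<close> is invariant. By
  isotropy irreducibility the induced metric is, up to a constant factor, the metric of the
  symmetric space, so it yields the same harmonic maps.
\<close>

definition harmonic_map_G2_SO4 ::
    "'m::t2_space set \<Rightarrow> 'm atlas \<Rightarrow> ('m \<Rightarrow> (complex^7) set) \<Rightarrow> bool"
  where "harmonic_map_G2_SO4 M \<A> \<phi> \<longleftrightarrow>
    (\<forall>p\<in>M. \<phi> p \<in> G2_SO4) \<and> harmonic_map M \<A> (iota ` G2_SO4) (\<lambda>p. iota (\<phi> p))"

definition A_z ::
    "'m set \<Rightarrow> ('m \<Rightarrow> complex) \<Rightarrow> ('m \<Rightarrow> (complex^'n) set) \<Rightarrow> 'm \<Rightarrow> complex^'n^'n"
  where "A_z U z \<phi> p =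
    (1/2) *\<^sub>R (matrix_inv (iota (\<phi> p)) ** d_z_mat U z (\<lambda>q. iota (\<phi> q)) p)"

text \<open>The power is that of the matrix product; \<open>^\<close> on vectors would be componentwise.\<close>

definition nilconformal :: "'m atlas \<Rightarrow> ('m \<Rightarrow> (complex^'n) set) \<Rightarrow> bool"
  where "nilconformal \<A> \<phi> \<longleftrightarrow>
    (\<forall>(U, z)\<in>\<A>. \<exists>r::nat. \<forall>p\<in>U. ((\<lambda>B. A_z U z \<phi> p ** B) ^^ r) (mat 1) = 0)"

end

theory Submission
  imports Defs
begin

text \<open>
  Work in a holomorphic coordinate \<open>z\<close> and write \<open>f\<close> for \<open>F\<close> regarded as a complex vector and
  \<open>(u, v)\<close> for the complex-bilinear dot product. Locally \<open>\<alpha>\<close> is spanned by a section \<open>s\<close> with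
  \<open>f \<times> s = \<i> s\<close>. Because \<open>u \<mapsto> f \<times> u\<close> is skew, any two vectors in its \<open>\<i>\<close>-eigenspace are orthogonal
  for the dot product and all of them are orthogonal to \<open>f\<close>. Since \<open>F\<close> is almost complex, \<open>f\<^sub>z\<close> lies in
  this eigenspace too, so the products of \<open>f\<close>, \<open>s\<close>, \<open>f\<^sub>z\<close> vanish except for \<open>(f, f) = 1\<close>.

  The space \<open>\<phi>\<close> is then the orthogonal sum of the lines of \<open>cnj s\<close>, \<open>f\<close> and \<open>s\<close>. It is the
  complexification of the span of \<open>F\<close>, \<open>y\<close> and \<open>F \<times> y\<close>, where \<open>y\<close> is the normalised real part of
  \<open>s\<close>; together with the unit these orthonormal vectors multiply like the quaternion units, so
  \<open>\<phi>\<close> has values in the associative subspaces (\<open>isotropic_span_in_G2_SO4\<close>).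

  Let \<open>P\<close> be the projection to \<open>\<phi>\<close>, \<open>Q = 1 - P\<close>, and let \<open>N\<close> and \<open>N'\<close> be the derivatives of \<open>P\<close> by
  \<open>z\<close> and by the conjugate coordinate. Both exchange \<open>\<phi>\<close> with its complement. On a section \<open>w\<close> of
  \<open>\<phi>\<close>, they act by \<open>w \<mapsto> Q w\<^sub>z\<close> and \<open>w \<mapsto> Q w\<^sub>z\<^sub>'\<close>. Three facts drive everything:

  \<^item> the holomorphy of \<open>\<alpha>\<close> says \<open>N' s = 0\<close>, and by conjugation \<open>N (cnj s) = 0\<close>;

  \<^item> \<open>s\<^sub>z\<close> and \<open>f\<^sub>z\<close> are orthogonal to \<open>s\<close> and \<open>f\<close>, so \<open>P s\<^sub>z\<close> and \<open>P f\<^sub>z\<close> are multiples of \<open>s\<close>;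

  \<^item> \<open>f\<close> satisfies \<open>\<Delta> f = k f\<close> for a scalar \<open>k\<close>, which expresses that almost complex maps are
    harmonic.

  Harmonicity. The tangent vectors of the space of reflections anticommute with \<open>\<iota> = 2 P - 1\<close>, and
  matrices that commute with \<open>\<iota>\<close> are orthogonal to them (\<open>anticommuting_orthogonal\<close>). Hence it
  suffices that the Laplacian of \<open>P\<close> commutes with \<open>P\<close>; as it is symmetric, that it preserves \<open>\<phi>\<close>.
  Differentiating \<open>P w = w\<close> twice expresses \<open>Q (\<Delta> P) w\<close> by \<open>Q \<Delta> w\<close>, \<open>Q N w\<^sub>z\<^sub>'\<close> and
  \<open>Q N' w\<^sub>z\<close>. For \<open>w = s\<close> and \<open>w = f\<close> the last term vanishes, since \<open>P w\<^sub>z\<close> is a multiple of \<open>s\<close> and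
  \<open>N' s = 0\<close>. The first two cancel for \<open>w = s\<close> because \<open>s\<^sub>z\<^sub>'\<close> is again a section of \<open>\<phi>\<close>; for \<open>w = f\<close>
  each of them vanishes. The case \<open>w = cnj s\<close> is conjugate to \<open>w = s\<close> (\<open>P_L_commute\<close>).

  Nilconformality. One has \<open>A = \<iota> N\<close>, and on \<open>\<phi>\<close> the square of \<open>A\<close> is \<open>- N N\<close>. As \<open>N\<close> is symmetric
  for the dot product, the products of \<open>N N w\<close> with vectors of \<open>\<phi>\<close> are products of \<open>N\<close>-images. This
  gives \<open>N N f = 0\<close> and \<open>N N s = k cnj s\<close>, besides \<open>N (cnj s) = 0\<close>. So \<open>A\<^sup>4 = 0\<close> on \<open>\<phi>\<close>, and since \<open>A\<close>
  maps the complement into \<open>\<phi>\<close>, \<open>A\<^sup>5 = 0\<close> (\<open>A_nilpotent\<close>).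
\<close>

section \<open>Smooth maps\<close>

lemma frechet_derivative_eq:
  "(f has_derivative f') (at x) \<Longrightarrow> frechet_derivative f (at x) = f'"
  by (rule frechet_derivative_at[symmetric])

lemma Ck_on_Suc_has_derivative:
  "Ck_on (Suc k) S f \<Longrightarrow> x \<in> S \<Longrightarrow> (f has_derivative frechet_derivative f (at x)) (at x)"
  by (simp add: frechet_derivative_works[symmetric])

lemma frechet_derivative_cong_open:
  assumes "open S" "x \<in> S" "\<And>y. y \<in> S \<Longrightarrow> f y = g y"
  shows "frechet_derivative f (at x) = frechet_derivative g (at x)"
proof -
  have "(f has_derivative f') (at x) \<longleftrightarrow> (g has_derivative f') (at x)" for f'
    using has_derivative_transform_within_open[OF _ assms(1,2), of f f' UNIV g]
      has_derivative_transform_within_open[OF _ assms(1,2), of g f' UNIV f] assms(3) by metis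
  then show ?thesis
    by (simp add: frechet_derivative_def)
qed

lemma differentiable_cong_open:
  assumes "open S" "x \<in> S" "\<And>y. y \<in> S \<Longrightarrow> f y = g y" "f differentiable (at x)"
  shows "g differentiable (at x)"
proof -
  obtain f' where "(f has_derivative f') (at x)"
    using assms(4) by (auto simp: differentiable_def)
  then have "(g has_derivative f') (at x)"
    by (rule has_derivative_transform_within_open[OF _ assms(1-3)])
  then show ?thesis by (rule differentiableI)
qed

lemma Ck_on_cong:
  assumes "open S" "\<And>x. x \<in> S \<Longrightarrow> f x = g x" "Ck_on k S f"
  shows "Ck_on k S g"
  using assms(2,3)
proof (induction k arbitrary: f g)
  case 0
  then show ?case using continuous_on_cong[of S S f g] by simp
next
  case (Suc k)
  have "g differentiable (at x)" if "x \<in> S" for x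
    by (rule differentiable_cong_open[OF assms(1) that Suc.prems(1)]) (use Suc.prems(2) that in simp_all)
  moreover have "Ck_on k S (\<lambda>x. frechet_derivative g (at x) v)" for v
  proof (rule Suc.IH[of "\<lambda>x. frechet_derivative f (at x) v"])
    show "frechet_derivative f (at x) v = frechet_derivative g (at x) v" if "x \<in> S" for x
      by (simp add: frechet_derivative_cong_open[OF assms(1) that Suc.prems(1)])
  qed (use Suc.prems in auto)
  ultimately show ?case by simp
qed

lemma Ck_on_subset: "Ck_on k S f \<Longrightarrow> T \<subseteq> S \<Longrightarrow> Ck_on k T f"
proof (induction k arbitrary: f)
  case 0
  then show ?case by (auto intro: continuous_on_subset)
next
  case (Suc k)
  then show ?case by (simp add: subset_iff)
qed

lemma Ck_on_local:
  assumes "\<And>x. x \<in> S \<Longrightarrow> \<exists>T. open T \<and> x \<in> T \<and> Ck_on k T f"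
  shows "Ck_on k S f"
  using assms
proof (induction k arbitrary: f)
  case 0
  have "isCont f x" if x: "x \<in> S" for x
  proof -
    obtain T where "open T" "x \<in> T" "continuous_on T f"
      using 0[OF x] by auto
    then show ?thesis by (simp add: continuous_on_eq_continuous_at)
  qed
  then show ?case
    by (simp add: continuous_at_imp_continuous_on)
next
  case (Suc k)
  have "f differentiable (at x)" if x: "x \<in> S" for x
    using Suc.prems[OF x] by auto
  moreover have "Ck_on k S (\<lambda>x. frechet_derivative f (at x) v)" for v
  proof (rule Suc.IH)
    fix x assume x: "x \<in> S"
    obtain T where "open T" "x \<in> T" "Ck_on (Suc k) T f"
      using Suc.prems[OF x] by auto
    then show "\<exists>T. open T \<and> x \<in> T \<and> Ck_on k T (\<lambda>x. frechet_derivative f (at x) v)"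
      by (intro exI[of _ T]) simp
  qed
  ultimately show ?case by simp
qed

lemma Ck_on_Suc_imp: "Ck_on (Suc k) S f \<Longrightarrow> Ck_on k S f"
proof (induction k arbitrary: f)
  case 0
  then have "f differentiable_on S"
    by (simp add: differentiable_on_def differentiable_at_withinI)
  then show ?case
    by (simp add: differentiable_imp_continuous_on)
next
  case (Suc k)
  have "Ck_on k S (\<lambda>x. frechet_derivative f (at x) v)" for v
    by (rule Suc.IH) (use Suc.prems in simp)
  moreover have "\<forall>x\<in>S. f differentiable (at x)"
    using Suc.prems by simp
  ultimately show ?case by simp
qed

lemma Ck_on_const: "Ck_on k S (\<lambda>x. c)"
  by (induction k arbitrary: c) auto

lemma Ck_on_bounded_linear:
  assumes "bounded_linear L" "open S" "Ck_on k S f"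
  shows "Ck_on k S (\<lambda>x. L (f x))"
  using assms(3)
proof (induction k arbitrary: f)
  case 0
  then show ?case
    using assms(1) by (simp add: bounded_linear.continuous_on)
next
  case (Suc k)
  have D: "((\<lambda>x. L (f x)) has_derivative (\<lambda>v. L (frechet_derivative f (at x) v))) (at x)"
    if "x \<in> S" for x
    by (rule bounded_linear.has_derivative[OF assms(1) Ck_on_Suc_has_derivative[OF Suc.prems that]])
  have "Ck_on k S (\<lambda>x. frechet_derivative (\<lambda>x. L (f x)) (at x) v)" for v
    by (rule Ck_on_cong[OF assms(2) _ Suc.IH[of "\<lambda>x. frechet_derivative f (at x) v"]])
      (use Suc.prems in \<open>simp_all add: frechet_derivative_eq[OF D]\<close>)
  then show ?case
    using differentiableI[OF D] by simp
qed

lemma Ck_on_add: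
  assumes "open S" "Ck_on k S f" "Ck_on k S g"
  shows "Ck_on k S (\<lambda>x. f x + g x)"
  using assms(2,3)
proof (induction k arbitrary: f g)
  case 0
  then show ?case by (simp add: continuous_on_add)
next
  case (Suc k)
  have D: "((\<lambda>x. f x + g x) has_derivative
      (\<lambda>v. frechet_derivative f (at x) v + frechet_derivative g (at x) v)) (at x)"
    if "x \<in> S" for x
    by (rule has_derivative_add[OF Ck_on_Suc_has_derivative[OF Suc.prems(1) that]
          Ck_on_Suc_has_derivative[OF Suc.prems(2) that]])
  have "Ck_on k S (\<lambda>x. frechet_derivative (\<lambda>x. f x + g x) (at x) v)" for v
    by (rule Ck_on_cong[OF assms(1) _ Suc.IH[of "\<lambda>x. frechet_derivative f (at x) v"
            "\<lambda>x. frechet_derivative g (at x) v"]])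
      (use Suc.prems in \<open>simp_all add: frechet_derivative_eq[OF D]\<close>)
  then show ?case
    using differentiableI[OF D] by simp
qed

lemma Ck_on_bounded_bilinear:
  assumes "bounded_bilinear B" "open S" "Ck_on k S f" "Ck_on k S g"
  shows "Ck_on k S (\<lambda>x. B (f x) (g x))"
  using assms(3,4)
proof (induction k arbitrary: f g)
  case 0
  then show ?case
    using assms(1) by (simp add: bounded_bilinear.continuous_on)
next
  case (Suc k)
  have D: "((\<lambda>x. B (f x) (g x)) has_derivative
      (\<lambda>v. B (f x) (frechet_derivative g (at x) v) + B (frechet_derivative f (at x) v) (g x))) (at x)"
    if "x \<in> S" for x
    by (rule bounded_bilinear.FDERIV[OF assms(1) Ck_on_Suc_has_derivative[OF Suc.prems(1) that]
          Ck_on_Suc_has_derivative[OF Suc.prems(2) that]])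
  have "Ck_on k S (\<lambda>x. frechet_derivative (\<lambda>x. B (f x) (g x)) (at x) v)" for v
  proof (rule Ck_on_cong[OF assms(2)])
    show "Ck_on k S (\<lambda>x. B (f x) (frechet_derivative g (at x) v)
        + B (frechet_derivative f (at x) v) (g x))"
      using Suc.prems Ck_on_Suc_imp[OF Suc.prems(1)] Ck_on_Suc_imp[OF Suc.prems(2)]
      by (intro Ck_on_add[OF assms(2)] Suc.IH) auto
  qed (simp add: frechet_derivative_eq[OF D])
  then show ?case
    using differentiableI[OF D] by simp
qed

lemma Ck_on_inverse:
  fixes f :: "'a::real_normed_vector \<Rightarrow> real"
  assumes "open S" "\<And>x. x \<in> S \<Longrightarrow> f x \<noteq> 0" "Ck_on k S f"
  shows "Ck_on k S (\<lambda>x. inverse (f x))"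
  using assms(3)
proof (induction k)
  case 0
  then have "continuous_on S f" by simp
  then have "continuous_on S (\<lambda>x. inverse (f x))"
    by (rule continuous_on_inverse) (use assms(2) in blast)
  then show ?case by simp
next
  case (Suc k)
  have D: "((\<lambda>x. inverse (f x)) has_derivative
      (\<lambda>v. - (inverse (f x) * frechet_derivative f (at x) v * inverse (f x)))) (at x)"
    if "x \<in> S" for x
    by (rule Deriv.has_derivative_inverse[OF assms(2)[OF that] Ck_on_Suc_has_derivative[OF Suc.prems that]])
  have C: "Ck_on k S (\<lambda>x. inverse (f x))"
    using Suc.IH Ck_on_Suc_imp[OF Suc.prems] by simp
  have "Ck_on k S (\<lambda>x. frechet_derivative (\<lambda>x. inverse (f x)) (at x) v)" for v
  proof (rule Ck_on_cong[OF assms(1)])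
    show "Ck_on k S (\<lambda>x. - (inverse (f x) * frechet_derivative f (at x) v * inverse (f x)))"
      by (rule Ck_on_bounded_linear[OF bounded_linear_minus[OF bounded_linear_ident] assms(1)],
          rule Ck_on_bounded_bilinear[OF bounded_bilinear_mult assms(1)
            Ck_on_bounded_bilinear[OF bounded_bilinear_mult assms(1) C] C])
        (use Suc.prems in simp)
  qed (simp add: frechet_derivative_eq[OF D])
  then show ?case
    using differentiableI[OF D] by simp
qed

lemma smooth_on_differentiable: "smooth_on S f \<Longrightarrow> x \<in> S \<Longrightarrow> f differentiable (at x)"
  unfolding smooth_on_def using Ck_on.simps(2) by blast

lemma smooth_on_derivative: "smooth_on S f \<Longrightarrow> smooth_on S (\<lambda>x. frechet_derivative f (at x) v)"
  unfolding smooth_on_def using Ck_on.simps(2) by blast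

lemma smooth_on_has_derivative:
  "smooth_on S f \<Longrightarrow> x \<in> S \<Longrightarrow> (f has_derivative frechet_derivative f (at x)) (at x)"
  using smooth_on_differentiable frechet_derivative_works by blast

section \<open>Symmetry of second derivatives\<close>

text \<open>
  The second difference in the directions \<open>u\<close> and \<open>v\<close> is symmetric in \<open>u\<close> and \<open>v\<close>, while its limit is
  computed here as an iterated derivative; comparing both orders of the directions gives the
  symmetry of second derivatives. By the mean value theorem along \<open>u\<close>, the second difference is \<open>t\<close>
  times a difference of values of \<open>g' _ u\<close>, to which differentiability at the single point \<open>x\<close>
  applies.
\<close>
lemma second_difference_quotient_tendsto:
  fixes g :: "'a::real_normed_vector \<Rightarrow> real"
  assumes S: "open S" "x \<in> S"
    and g: "\<And>y. y \<in> S \<Longrightarrow> (g has_derivative g' y) (at y)"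
    and g': "((\<lambda>y. g' y u) has_derivative g'') (at x)"
  shows "((\<lambda>t. (g (x + t *\<^sub>R u + t *\<^sub>R v) - g (x + t *\<^sub>R u) - g (x + t *\<^sub>R v) + g x) / t\<^sup>2)
    \<longlongrightarrow> g'' v) (at_right 0)"
proof (rule tendstoI)
  fix e :: real assume "e > 0"
  \<comment> \<open>\<open>t * K\<close> bounds the distance to \<open>x\<close> of all points of the parallelogram with sides \<open>t u\<close> and \<open>t v\<close>.\<close>
  define K where "K = 2 * (norm u + norm v) + 1"
  have K: "K > 0" "norm u \<le> K" "norm u + norm v \<le> K"
    unfolding K_def by (auto simp: add_nonneg_pos)
  obtain r where r: "r > 0" "ball x r \<subseteq> S"
    using S open_contains_ball by blast
  have g''_lin: "linear g''"
    using g' by (rule has_derivative_linear)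
  obtain d where d: "d > 0" "\<And>y. norm (y - x) < d \<Longrightarrow>
      \<bar>g' y u - g' x u - g'' (y - x)\<bar> \<le> e / (4 * K) * norm (y - x)"
  proof -
    have "e / (4 * K) > 0" using \<open>e > 0\<close> K by simp
    with g' obtain d where "d > 0" "\<And>y. norm (y - x) < d \<Longrightarrow>
        norm (g' y u - g' x u - g'' (y - x)) \<le> e / (4 * K) * norm (y - x)"
      unfolding has_derivative_at_alt by blast
    then show ?thesis using that by simp
  qed
  define b where "b = min r d / K"
  have "b > 0" unfolding b_def using r(1) d(1) K(1) by simp
  have "dist ((g (x + t *\<^sub>R u + t *\<^sub>R v) - g (x + t *\<^sub>R u) - g (x + t *\<^sub>R v) + g x) / t\<^sup>2) (g'' v) < e"
    if t: "0 < t" "t < b" for t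
  proof -
    define h where "h \<tau> = g (x + \<tau> *\<^sub>R u + t *\<^sub>R v) - g (x + \<tau> *\<^sub>R u)" for \<tau>
    have tK: "t * K < r" "t * K < d"
      using t(2) K(1) unfolding b_def by (simp_all add: pos_less_divide_eq)
    have near: "norm (\<tau> *\<^sub>R u + \<sigma> *\<^sub>R v) \<le> t * K" if "0 \<le> \<tau>" "\<tau> \<le> t" "0 \<le> \<sigma>" "\<sigma> \<le> t" for \<tau> \<sigma>
    proof -
      have "norm (\<tau> *\<^sub>R u + \<sigma> *\<^sub>R v) \<le> \<tau> * norm u + \<sigma> * norm v"
        using norm_triangle_ineq[of "\<tau> *\<^sub>R u" "\<sigma> *\<^sub>R v"] that by simp
      also have "\<dots> \<le> t * norm u + t * norm v"
        using that by (intro add_mono mult_right_mono) auto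
      also have "\<dots> \<le> t * K"
        using mult_left_mono[OF K(3), of t] t by (simp add: distrib_left)
      finally show ?thesis .
    qed
    have dist_add: "dist x (x + w) = norm w" for x w :: 'a
      by (simp add: dist_norm)
    have inS: "x + \<tau> *\<^sub>R u + \<sigma> *\<^sub>R v \<in> S" if "0 \<le> \<tau>" "\<tau> \<le> t" "0 \<le> \<sigma>" "\<sigma> \<le> t" for \<tau> \<sigma>
    proof -
      have "dist x (x + (\<tau> *\<^sub>R u + \<sigma> *\<^sub>R v)) = norm (\<tau> *\<^sub>R u + \<sigma> *\<^sub>R v)"
        using dist_add[of x] by simp
      also have "\<dots> < r" using near[OF that] tK(1) by linarith
      finally have "x + (\<tau> *\<^sub>R u + \<sigma> *\<^sub>R v) \<in> S" using r(2) by auto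
      then show ?thesis by (simp add: add.assoc)
    qed
    have der: "((\<lambda>\<tau>. g (x + \<tau> *\<^sub>R u + \<sigma> *\<^sub>R v)) has_real_derivative g' (x + \<tau> *\<^sub>R u + \<sigma> *\<^sub>R v) u) (at \<tau>)"
      if "0 \<le> \<tau>" "\<tau> \<le> t" "0 \<le> \<sigma>" "\<sigma> \<le> t" for \<tau> \<sigma>
    proof -
      have "((\<lambda>\<tau>. x + \<tau> *\<^sub>R u + \<sigma> *\<^sub>R v) has_derivative (\<lambda>\<tau>. \<tau> *\<^sub>R u)) (at \<tau>)"
        by (auto intro!: derivative_eq_intros)
      from has_derivative_compose[OF this g[OF inS[OF that]]]
      have "((\<lambda>\<tau>. g (x + \<tau> *\<^sub>R u + \<sigma> *\<^sub>R v)) has_derivative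
          (\<lambda>c. g' (x + \<tau> *\<^sub>R u + \<sigma> *\<^sub>R v) (c *\<^sub>R u))) (at \<tau>)" .
      moreover have "linear (g' (x + \<tau> *\<^sub>R u + \<sigma> *\<^sub>R v))"
        using g[OF inS[OF that]] by (rule has_derivative_linear)
      ultimately show ?thesis
        by (simp add: has_field_derivative_def linear_scale mult_commute_abs)
    qed
    have "\<exists>z. 0 < z \<and> z < t \<and>
        h t - h 0 = (t - 0) * (g' (x + z *\<^sub>R u + t *\<^sub>R v) u - g' (x + z *\<^sub>R u) u)"
    proof (rule MVT2[OF t(1)])
      fix \<tau> assume "0 \<le> \<tau>" "\<tau> \<le> t"
      then show "(h has_real_derivative g' (x + \<tau> *\<^sub>R u + t *\<^sub>R v) u - g' (x + \<tau> *\<^sub>R u) u) (at \<tau>)"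
        using DERIV_diff[OF der[of \<tau> t] der[of \<tau> 0]] t by (simp add: h_def[abs_def])
    qed
    then obtain z where z: "0 < z" "z < t"
      "h t - h 0 = t * (g' (x + z *\<^sub>R u + t *\<^sub>R v) u - g' (x + z *\<^sub>R u) u)" by auto
    define y1 where "y1 = x + z *\<^sub>R u + t *\<^sub>R v"
    define y2 where "y2 = x + z *\<^sub>R u"
    have n: "norm (y1 - x) \<le> t * K" "norm (y2 - x) \<le> t * K"
      using near[of z t] near[of z 0] z t by (auto simp: y1_def y2_def add.assoc)
    have e1: "\<bar>g' w u - g' x u - g'' (w - x)\<bar> \<le> e / 4 * t" if "norm (w - x) \<le> t * K" for w
    proof -
      have "\<bar>g' w u - g' x u - g'' (w - x)\<bar> \<le> e / (4 * K) * norm (w - x)"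
        using d(2)[of w] that tK(2) by linarith
      also have "\<dots> \<le> e / (4 * K) * (t * K)"
        using that \<open>e > 0\<close> K by (intro mult_left_mono) auto
      finally show ?thesis using K by simp
    qed
    have "g'' (y1 - x) = z * g'' u + t * g'' v" "g'' (y2 - x) = z * g'' u"
      by (simp_all add: y1_def y2_def add.assoc linear_add[OF g''_lin] linear_scale[OF g''_lin])
    then have "\<bar>(g' y1 u - g' y2 u) - t * g'' v\<bar> \<le> e / 2 * t"
      using e1[OF n(1)] e1[OF n(2)] by (simp only: abs_le_iff) (linarith)
    moreover have "g (x + t *\<^sub>R u + t *\<^sub>R v) - g (x + t *\<^sub>R u) - g (x + t *\<^sub>R v) + g x
        = t * (g' y1 u - g' y2 u)"
      using z(3) by (simp add: h_def y1_def y2_def)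
    moreover have "t * A / t\<^sup>2 - B = (A - t * B) / t" for A B
      using t by (simp add: power2_eq_square diff_divide_distrib)
    ultimately have "dist ((g (x + t *\<^sub>R u + t *\<^sub>R v) - g (x + t *\<^sub>R u) - g (x + t *\<^sub>R v) + g x) / t\<^sup>2) (g'' v)
        \<le> e / 2"
      using t by (simp add: dist_real_def pos_divide_le_eq)
    then show ?thesis using \<open>e > 0\<close> by simp
  qed
  then show "\<forall>\<^sub>F t in at_right 0. dist ((g (x + t *\<^sub>R u + t *\<^sub>R v) - g (x + t *\<^sub>R u)
      - g (x + t *\<^sub>R v) + g x) / t\<^sup>2) (g'' v) < e"
    using \<open>b > 0\<close> unfolding eventually_at_right_field by blast
qed

lemma second_derivative_symmetric:
  fixes f :: "'a::real_normed_vector \<Rightarrow> 'b::euclidean_space"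
  assumes S: "open S" "x \<in> S" and f: "smooth_on S f"
  shows "frechet_derivative (\<lambda>y. frechet_derivative f (at y) u) (at x) v =
    frechet_derivative (\<lambda>y. frechet_derivative f (at y) v) (at x) u"
proof (rule euclidean_eqI)
  fix b :: 'b assume "b \<in> Basis"
  let ?g = "\<lambda>y. f y \<bullet> b" and ?g' = "\<lambda>y w. frechet_derivative f (at y) w \<bullet> b"
  let ?D2 = "\<lambda>w w'. frechet_derivative (\<lambda>y. frechet_derivative f (at y) w) (at x) w' \<bullet> b"
  let ?q = "\<lambda>u v t. (?g (x + t *\<^sub>R u + t *\<^sub>R v) - ?g (x + t *\<^sub>R u) - ?g (x + t *\<^sub>R v) + ?g x) / t\<^sup>2"
  have lim: "(?q u v \<longlongrightarrow> ?D2 u v) (at_right 0)" for u v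
  proof (rule second_difference_quotient_tendsto[OF S, where g = ?g and g' = ?g'])
    show "(?g has_derivative ?g' y) (at y)" if "y \<in> S" for y
      by (intro has_derivative_inner_left smooth_on_has_derivative[OF f that])
    show "((\<lambda>y. ?g' y u) has_derivative ?D2 u) (at x)"
      by (intro has_derivative_inner_left
          smooth_on_has_derivative[OF smooth_on_derivative[OF f] S(2)])
  qed
  have swap: "x + t *\<^sub>R v + t *\<^sub>R u = x + t *\<^sub>R u + t *\<^sub>R v" for t
    by (simp add: add.assoc add.commute)
  have "?q u v = ?q v u"
    unfolding swap by (intro ext arg_cong[where f = "\<lambda>a. a / _"]) linarith
  then have "(?q u v \<longlongrightarrow> ?D2 v u) (at_right 0)"
    by (simp only: lim)
  then show "?D2 u v = ?D2 v u"
    by (rule tendsto_unique[OF trivial_limit_at_right_real lim])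
qed

section \<open>The vector product over a commutative ring\<close>

lemma exhaust_7:
  fixes x :: 7
  shows "x = 1 \<or> x = 2 \<or> x = 3 \<or> x = 4 \<or> x = 5 \<or> x = 6 \<or> x = 7"
proof (induct x)
  case (of_int z)
  then have "z = 0 \<or> z = 1 \<or> z = 2 \<or> z = 3 \<or> z = 4 \<or> z = 5 \<or> z = 6" by fastforce
  then show ?case by auto
qed

lemma forall_7: "(\<forall>i::7. P i) \<longleftrightarrow> P 1 \<and> P 2 \<and> P 3 \<and> P 4 \<and> P 5 \<and> P 6 \<and> P 7"
  by (metis exhaust_7)

lemma UNIV_7: "UNIV = {1, 2, 3, 4, 5, 6, 7::7}"
  using exhaust_7 by auto

lemma sum_7: "sum f (UNIV::7 set) = f 1 + f 2 + f 3 + f 4 + f 5 + f 6 + f 7"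
  unfolding UNIV_7 by (simp add: ac_simps)

lemma vector_7:
  "vector [a, b, c, d, e, f, g] $ (1::7) = (a::'a::zero)"
  "vector [a, b, c, d, e, f, g] $ (2::7) = b"
  "vector [a, b, c, d, e, f, g] $ (3::7) = c"
  "vector [a, b, c, d, e, f, g] $ (4::7) = d"
  "vector [a, b, c, d, e, f, g] $ (5::7) = e"
  "vector [a, b, c, d, e, f, g] $ (6::7) = f"
  "vector [a, b, c, d, e, f, g] $ (7::7) = g"
  unfolding vector_def by auto

definition bdot :: "'a::comm_ring_1^'n \<Rightarrow> 'a^'n \<Rightarrow> 'a"
  where "bdot v w = (\<Sum>i\<in>UNIV. v$i * w$i)"

text \<open>
  The coordinate formula of the octonionic vector product makes sense over every commutative ring.
  Over the reals it is \<open>cross7\<close>, over the complex numbers it is the bilinear extension \<open>ccross7\<close>,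
  so that the polynomial identities below serve both.
\<close>
definition vprod :: "'a::comm_ring_1^7 \<Rightarrow> 'a^7 \<Rightarrow> 'a^7"
  where "vprod v w = vector [
    v$2 * w$3 - v$3 * w$2 + v$4 * w$5 - v$5 * w$4 + v$7 * w$6 - v$6 * w$7,
    v$3 * w$1 - v$1 * w$3 + v$4 * w$6 - v$6 * w$4 + v$5 * w$7 - v$7 * w$5,
    v$1 * w$2 - v$2 * w$1 + v$4 * w$7 - v$7 * w$4 + v$6 * w$5 - v$5 * w$6,
    v$5 * w$1 - v$1 * w$5 + v$6 * w$2 - v$2 * w$6 + v$7 * w$3 - v$3 * w$7,
    v$1 * w$4 - v$4 * w$1 + v$7 * w$2 - v$2 * w$7 + v$3 * w$6 - v$6 * w$3,
    v$1 * w$7 - v$7 * w$1 + v$2 * w$4 - v$4 * w$2 + v$5 * w$3 - v$3 * w$5,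
    v$6 * w$1 - v$1 * w$6 + v$2 * w$5 - v$5 * w$2 + v$3 * w$4 - v$4 * w$3]"

lemmas vec7_simps = vec_eq_iff forall_7 bdot_def sum_7 vprod_def vector_7

lemma cross7_eq_vprod: "cross7 v w = vprod v w"
  by (simp add: cross7_def octo_Im_def imag_octo_def octo_mult_def quat_mult_def quat_cnj_def
      vec7_simps algebra_simps)

lemma ccross7_eq_vprod: "ccross7 v w = vprod v w"
  by (simp add: ccross7_def cross7_eq_vprod Re_vec_def Im_vec_def cvec_def vec7_simps complex_eq_iff
      algebra_simps)

lemma vprod_vprod_left: "vprod u (vprod u v) = bdot u v *s u - bdot u u *s v"
  by (simp add: vec7_simps algebra_simps)

lemma vprod_vprod_right: "vprod (vprod u v) v = bdot u v *s v - bdot v v *s u"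
  by (simp add: vec7_simps algebra_simps)

lemma bdot_vprod_skew: "bdot (vprod u v) w = - bdot v (vprod u w)"
  by (simp add: vec7_simps algebra_simps)

lemma bdot_vprod_self: "bdot u (vprod u v) = 0"
  by (simp add: vec7_simps algebra_simps)

lemma vprod_add_left: "vprod (u + v) w = vprod u w + vprod v w"
  by (simp add: vec7_simps algebra_simps)

lemma vprod_add_right: "vprod w (u + v) = vprod w u + vprod w v"
  by (simp add: vec7_simps algebra_simps)

lemma vprod_scale_left: "vprod (c *s u) w = c *s vprod u w"
  by (simp add: vec7_simps algebra_simps)

lemma vprod_scale_right: "vprod w (c *s u) = c *s vprod w u"
  by (simp add: vec7_simps algebra_simps)

section \<open>Orthogonal projections and their reflections\<close>

lemma cnj_vec_cnj_vec [simp]: "cnj_vec (cnj_vec v) = v"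
  by (simp add: cnj_vec_def vec_eq_iff)

lemma cnj_vec_cvec [simp]: "cnj_vec (cvec x) = cvec x"
  by (simp add: cnj_vec_def cvec_def)

lemma hermitian_eq_bdot: "hermitian v w = bdot v (cnj_vec w)"
  by (simp add: hermitian_def bdot_def cnj_vec_def)

lemma bdot_commute: "bdot v w = bdot w v"
  by (simp add: bdot_def mult.commute)

lemma bdot_add_left: "bdot (u + v) w = bdot u w + bdot v w"
  by (simp add: bdot_def distrib_right sum.distrib)

lemma bdot_diff_left: "bdot (u - v) w = bdot u w - bdot v w"
  by (simp add: bdot_def left_diff_distrib sum_subtractf)

lemma bdot_scale_left: "bdot (c *s u) w = c * bdot u w"
  by (simp add: bdot_def sum_distrib_left mult.assoc)

lemma bdot_add_right: "bdot w (u + v) = bdot w u + bdot w v"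
  by (simp add: bdot_commute[of w] bdot_add_left)

lemma bdot_diff_right: "bdot w (u - v) = bdot w u - bdot w v"
  by (simp add: bdot_commute[of w] bdot_diff_left)

lemma bdot_scale_right: "bdot w (c *s u) = c * bdot w u"
  by (simp add: bdot_commute[of w] bdot_scale_left)

lemma bdot_zero [simp]: "bdot 0 w = 0" "bdot w 0 = 0"
  by (simp_all add: bdot_def)

lemmas bdot_simps = bdot_add_left bdot_diff_left bdot_scale_left
  bdot_add_right bdot_diff_right bdot_scale_right

lemma bdot_cnj_self: "bdot v (cnj_vec v) = of_real (inner v v)"
  by (simp add: bdot_def cnj_vec_def inner_vec_def complex_mult_cnj cmod_power2
      power2_norm_eq_inner[symmetric] del: of_real_add)

lemma hermitian_cnj: "hermitian v w = cnj (hermitian w v)"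
  by (simp add: hermitian_def mult.commute)

lemma subspace_hperp: "vec.subspace (hperp W)"
  by (simp add: vec.subspace_def hperp_def hermitian_eq_bdot bdot_simps)

text \<open>
  A matrix that decomposes every vector orthogonally along \<open>W\<close>. For subspaces this determines \<open>hproj\<close>
  and \<open>iota\<close> without reference to the definite description.
\<close>
definition orthoproj :: "complex^'n^'n \<Rightarrow> (complex^'n) set \<Rightarrow> bool"
  where "orthoproj P W \<longleftrightarrow> (\<forall>v. P *v v \<in> W \<and> v - P *v v \<in> hperp W)"

lemma hproj_eqI:
  assumes W: "vec.subspace W" and w: "w \<in> W" "v - w \<in> hperp W"
  shows "hproj W v = w"
  unfolding hproj_def
proof (rule the_equality)
  show "w \<in> W \<and> v - w \<in> hperp W" using w by simp
  fix w' assume w': "w' \<in> W \<and> v - w' \<in> hperp W"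
  have "w - w' \<in> W" using W w(1) w' by (simp add: vec.subspace_diff)
  moreover have "(v - w') - (v - w) \<in> hperp W"
    by (rule vec.subspace_diff[OF subspace_hperp]) (use w w' in auto)
  ultimately have "hermitian (w - w') (w - w') = 0"
    unfolding hperp_def by simp
  then show "w' = w"
    by (simp add: hermitian_eq_bdot bdot_cnj_self)
qed

lemma orthoproj_apply:
  assumes "vec.subspace W" "orthoproj P W" "w \<in> W"
  shows "P *v w = w"
proof -
  have "hproj W w = P *v w"
    by (rule hproj_eqI) (use assms in \<open>auto simp: orthoproj_def\<close>)
  moreover have "hproj W w = w"
    by (rule hproj_eqI) (use assms in \<open>auto simp: hperp_def hermitian_eq_bdot\<close>)
  ultimately show ?thesis by simp
qed

lemma orthoproj_idempotent:
  assumes "vec.subspace W" "orthoproj P W"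
  shows "P ** P = P"
proof -
  have "(P ** P) *v v = P *v v" for v
    using orthoproj_apply[OF assms, of "P *v v"] assms(2)
    by (simp add: matrix_vector_mul_assoc[symmetric] orthoproj_def)
  then show ?thesis by (simp add: matrix_eq)
qed

lemma iota_eq:
  assumes W: "vec.subspace W" and P: "orthoproj P W"
  shows "iota W = P - (mat 1 - P)"
proof -
  have 1: "hproj W = (\<lambda>v. P *v v)"
    using P by (auto intro!: hproj_eqI[OF W] simp: orthoproj_def)
  have "hproj (hperp W) v = (mat 1 - P) *v v" for v
  proof (rule hproj_eqI[OF subspace_hperp])
    show "(mat 1 - P) *v v \<in> hperp W"
      using P by (simp add: orthoproj_def matrix_vector_mult_diff_rdistrib)
    have "P *v v \<in> W" using P by (simp add: orthoproj_def)
    then have "hermitian (P *v v) w = 0" if "w \<in> hperp W" for w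
      using that hermitian_cnj[of "P *v v" w] by (simp add: hperp_def)
    then show "v - (mat 1 - P) *v v \<in> hperp (hperp W)"
      by (simp add: matrix_vector_mult_diff_rdistrib hperp_def[of "hperp W"])
  qed
  then have 2: "hproj (hperp W) = (\<lambda>v. (mat 1 - P) *v v)" by blast
  show ?thesis
    unfolding iota_def 1 2 by simp
qed

lemma iota_involution:
  assumes W: "vec.subspace W" and P: "orthoproj P W"
  shows "iota W ** iota W = mat 1"
proof -
  have "(P - (mat 1 - P)) *v ((P - (mat 1 - P)) *v v) = v" for v
  proof -
    have "P *v (P *v v) = P *v v"
      using orthoproj_idempotent[OF W P] by (simp add: matrix_vector_mul_assoc)
    then show ?thesis
      by (simp only: matrix_vector_mult_diff_rdistrib matrix_vector_mult_diff_distrib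
          matrix_vector_mul_lid) simp
  qed
  then show ?thesis
    by (simp add: iota_eq[OF W P] matrix_eq matrix_vector_mul_assoc[symmetric])
qed

text \<open>
  Uniqueness of the orthogonal decomposition makes the projection linear, hence a matrix.
\<close>
lemma orthoproj_matrix_hproj:
  assumes W: "vec.subspace W" and ex: "\<And>v. \<exists>w\<in>W. v - w \<in> hperp W"
  shows "orthoproj (matrix (hproj W)) W"
proof -
  have h: "hproj W v \<in> W \<and> v - hproj W v \<in> hperp W" for v
  proof -
    obtain w where w: "w \<in> W" "v - w \<in> hperp W" using ex by blast
    then show ?thesis using hproj_eqI[OF W w] by simp
  qed
  have "hproj W (u + v) = hproj W u + hproj W v" for u v
  proof (rule hproj_eqI[OF W])
    show "hproj W u + hproj W v \<in> W" using h W by (simp add: vec.subspace_add)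
    have "(u - hproj W u) + (v - hproj W v) \<in> hperp W"
      using h subspace_hperp by (blast intro: vec.subspace_add)
    then show "u + v - (hproj W u + hproj W v) \<in> hperp W" by (simp add: algebra_simps)
  qed
  moreover have "hproj W (c *s v) = c *s hproj W v" for c v
  proof (rule hproj_eqI[OF W])
    show "c *s hproj W v \<in> W" using h W by (simp add: vec.subspace_scale)
    have "c *s (v - hproj W v) \<in> hperp W"
      using h subspace_hperp by (blast intro: vec.subspace_scale)
    then show "c *s v - c *s hproj W v \<in> hperp W"
      by (simp add: vec.scale_right_diff_distrib)
  qed
  ultimately have "Vector_Spaces.linear (*s) (*s) (hproj W)"
    by unfold_locales
  then show ?thesis
    using h by (simp add: orthoproj_def matrix_works)
qed

lemma subspace_complexification:
  assumes "subspace W"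
  shows "vec.subspace (complexification W)"
proof (rule vec.subspaceI)
  have "0 = cvec 0 + \<i> *s cvec 0" by (simp add: vec_eq_iff cvec_def)
  then show "0 \<in> complexification W"
    unfolding complexification_def using subspace_0[OF assms] by blast
next
  fix x y assume "x \<in> complexification W" "y \<in> complexification W"
  then obtain a b c d where W: "a \<in> W" "b \<in> W" "c \<in> W" "d \<in> W"
    and "x = cvec a + \<i> *s cvec b" "y = cvec c + \<i> *s cvec d"
    unfolding complexification_def by blast
  then have "x + y = cvec (a + c) + \<i> *s cvec (b + d)"
    by (simp add: vec_eq_iff cvec_def algebra_simps)
  then show "x + y \<in> complexification W"
    unfolding complexification_def using W subspace_add[OF assms] by blast
next
  fix k x assume "x \<in> complexification W"
  then obtain a b where W: "a \<in> W" "b \<in> W" and "x = cvec a + \<i> *s cvec b"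
    unfolding complexification_def by blast
  then have "k *s x = cvec (Re k *\<^sub>R a - Im k *\<^sub>R b) + \<i> *s cvec (Im k *\<^sub>R a + Re k *\<^sub>R b)"
    by (simp add: vec_eq_iff cvec_def complex_eq_iff algebra_simps)
  then show "k *s x \<in> complexification W"
    unfolding complexification_def
    using W subspace_add[OF assms] subspace_diff[OF assms] subspace_scale[OF assms] by blast
qed

lemma bdot_cvec: "bdot (cvec x) (cvec y) = of_real (inner x y)"
  by (simp add: bdot_def cvec_def inner_vec_def)

text \<open>The real orthogonal decompositions of real and imaginary part combine.\<close>
lemma complexification_decomposition:
  assumes "subspace W"
  shows "\<exists>w\<in>complexification W. v - w \<in> hperp (complexification W)"
proof -
  have real: "\<exists>y\<in>W. \<forall>w\<in>W. (x - y) \<bullet> w = 0" for x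
  proof -
    obtain y z where yz: "y \<in> span W" "\<And>w. w \<in> span W \<Longrightarrow> orthogonal z w" "x = y + z"
      using orthogonal_subspace_decomp_exists by blast
    then have "\<forall>w\<in>W. (x - y) \<bullet> w = 0"
      by (auto simp: orthogonal_def intro: span_base)
    then show ?thesis using yz(1) assms span_eq_iff by blast
  qed
  obtain a b where ab: "a \<in> W" "\<And>w. w \<in> W \<Longrightarrow> (Re_vec v - a) \<bullet> w = 0"
    "b \<in> W" "\<And>w. w \<in> W \<Longrightarrow> (Im_vec v - b) \<bullet> w = 0"
    using real[of "Re_vec v"] real[of "Im_vec v"] by blast
  have v: "v - (cvec a + \<i> *s cvec b) = cvec (Re_vec v - a) + \<i> *s cvec (Im_vec v - b)"
    by (simp add: vec_eq_iff cvec_def Re_vec_def Im_vec_def complex_eq_iff)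
  have cnj: "cnj_vec (cvec c + \<i> *s cvec d) = cvec c - \<i> *s cvec d" for c d :: "real^'n"
    by (simp add: vec_eq_iff cvec_def cnj_vec_def)
  have "v - (cvec a + \<i> *s cvec b) \<in> hperp (complexification W)"
    unfolding v by (auto simp: hperp_def complexification_def hermitian_eq_bdot cnj bdot_simps
        bdot_cvec ab)
  then show ?thesis
    unfolding complexification_def using ab(1,3) by blast
qed

lemma iota_G2_SO4_involution:
  assumes "X \<in> iota ` G2_SO4"
  shows "X ** X = mat 1"
proof -
  obtain W where W: "subspace W" "X = iota (complexification W)"
    using assms unfolding G2_SO4_def associative_subspace_def by auto
  show ?thesis
    unfolding W(2)
    by (rule iota_involution[OF subspace_complexification[OF W(1)]
          orthoproj_matrix_hproj[OF subspace_complexification[OF W(1)]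
            complexification_decomposition[OF W(1)]]])
qed

section \<open>Associative subspaces\<close>

definition octo_of :: "real \<Rightarrow> real^7 \<Rightarrow> octo"
  where "octo_of r v = ((Complex r 0, 0), 0) + imag_octo v"

lemma octo_mult_octo_of:
  "octo_mult (octo_of r v) (octo_of s w) =
    octo_of (r * s - v \<bullet> w) (r *\<^sub>R w + s *\<^sub>R v + vprod v w)"
  by (simp add: octo_of_def imag_octo_def octo_mult_def quat_mult_def quat_cnj_def inner_vec_def
      vec7_simps complex_eq_iff prod_eq_iff algebra_simps)

lemma octo_Im_octo_of [simp]: "octo_Im (octo_of r v) = v"
  by (simp add: octo_of_def octo_Im_def imag_octo_def vec7_simps)

lemma octo_of_eq_0: "octo_of r v = 0 \<longleftrightarrow> r = 0 \<and> v = 0"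
  by (auto simp: octo_of_def imag_octo_def vec7_simps complex_eq_iff prod_eq_iff)

lemma octo_of_add: "octo_of (r + s) (v + w) = octo_of r v + octo_of s w"
  by (simp add: octo_of_def imag_octo_def complex_eq_iff prod_eq_iff)

lemma octo_of_scaleR: "octo_of (c * r) (c *\<^sub>R v) = c *\<^sub>R octo_of r v"
  by (simp add: octo_of_def imag_octo_def complex_eq_iff prod_eq_iff)

lemma vprod_scaleR: "vprod (c *\<^sub>R u) w = c *\<^sub>R vprod u w" "vprod u (c *\<^sub>R w) = c *\<^sub>R vprod u w"
  for u w :: "real^7"
  by (simp_all add: vprod_scale_left vprod_scale_right flip: scalar_mult_eq_scaleR)

lemma bdot_eq_inner: "bdot u v = u \<bullet> v" for u v :: "real^'n"
  by (simp add: bdot_def inner_vec_def)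

lemma bdot_vprod_self_right: "bdot v (vprod u v) = 0"
  by (simp add: vec7_simps algebra_simps)

lemma vprod_self [simp]: "vprod u u = 0"
  by (simp add: vec7_simps)

lemma vprod_swap: "vprod v u = - vprod u v"
  by (simp add: vec7_simps)

text \<open>
  With \<open>z = x \<times> y\<close>, the vectors \<open>x\<close>, \<open>y\<close>, \<open>z\<close> are orthonormal and their products are those of the
  quaternion units \<open>i\<close>, \<open>j\<close>, \<open>k\<close>, so the real-linear map sending the units to them is a
  homomorphism.
\<close>
lemma associative_subspace_span:
  fixes x y :: "real^7"
  assumes x: "x \<bullet> x = 1" and y: "y \<bullet> y = 1" and xy: "x \<bullet> y = 0"
  shows "associative_subspace {a *\<^sub>R x + b *\<^sub>R y + c *\<^sub>R vprod x y | a b c. True}"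
    (is "associative_subspace ?W")
proof -
  define z where "z = vprod x y"
  have xz: "x \<bullet> z = 0" and yz: "y \<bullet> z = 0"
    unfolding z_def bdot_eq_inner[symmetric]
    by (simp_all add: bdot_vprod_self bdot_vprod_self_right)
  have zz: "z \<bullet> z = 1"
    unfolding z_def bdot_eq_inner[symmetric] bdot_vprod_skew vprod_vprod_left
    by (simp add: bdot_simps bdot_eq_inner x y xy)
  have prods: "vprod x y = z" "vprod y x = - z" "vprod y z = x" "vprod z y = - x"
    "vprod z x = y" "vprod x z = - y"
    using vprod_vprod_left[of x y] vprod_vprod_right[of x y]
      vprod_swap[of y x] vprod_swap[of z y] vprod_swap[of z x]
    by (simp_all add: z_def[symmetric] bdot_eq_inner x y xy scalar_mult_eq_scaleR)
  have inners: "y \<bullet> x = 0" "z \<bullet> x = 0" "z \<bullet> y = 0"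
    using xy xz yz by (simp_all add: inner_commute)
  note tab = prods inners x y xy xz yz zz
  define g where "g q = Im (fst q) *\<^sub>R x + Re (snd q) *\<^sub>R y + Im (snd q) *\<^sub>R z" for q :: quat
  define h where "h q = octo_of (Re (fst q)) (g q)" for q :: quat
  have g_inner: "g q \<bullet> x = Im (fst q)" "g q \<bullet> y = Re (snd q)" "g q \<bullet> z = Im (snd q)" for q
    by (simp_all add: g_def inner_add_left tab)
  have g_add: "g (p + q) = g p + g q" for p q
    by (simp add: g_def algebra_simps)
  have g_scale: "g (c *\<^sub>R q) = c *\<^sub>R g q" for c q
    by (simp add: g_def algebra_simps)
  have lin: "linear h"
    by (rule linearI) (simp_all add: h_def g_add g_scale octo_of_add octo_of_scaleR)
  have inj: "inj h"
  proof (rule linear_injective_0[THEN iffD2, OF lin, rule_format])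
    fix q assume "h q = 0"
    then have "Re (fst q) = 0" "g q = 0" by (simp_all add: h_def octo_of_eq_0)
    then show "q = 0"
      using g_inner[of q] by (simp add: complex_eq_iff prod_eq_iff)
  qed
  have mult: "h (quat_mult p q) = octo_mult (h p) (h q)" for p q
  proof -
    have "g p \<bullet> g q = Im (fst p) * Im (fst q) + Re (snd p) * Re (snd q) + Im (snd p) * Im (snd q)"
      by (simp add: g_def[of q] inner_add_right g_inner)
    moreover have "g (quat_mult p q) = Re (fst p) *\<^sub>R g q + Re (fst q) *\<^sub>R g p + vprod (g p) (g q)"
      by (simp add: g_def vprod_add_left vprod_add_right vprod_scaleR tab quat_mult_def)
        (simp add: algebra_simps)
    ultimately show ?thesis
      by (simp add: h_def octo_mult_octo_of quat_mult_def diff_diff_eq add.assoc)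
  qed
  have "quaternion_subalgebra (range h)"
    unfolding quaternion_subalgebra_def
  proof (intro conjI exI[of _ h])
    show "subspace (range h)" by (rule linear_subspace_image[OF lin subspace_UNIV])
    show "\<forall>x\<in>range h. \<forall>y\<in>range h. octo_mult x y \<in> range h"
      by (auto simp: mult[symmetric])
    show "bij_betw h UNIV (range h)" using inj by (simp add: bij_betw_def)
  qed (auto simp: lin mult)
  moreover have W: "?W = octo_Im ` range h"
  proof -
    have "a *\<^sub>R x + b *\<^sub>R y + c *\<^sub>R z = octo_Im (h (Complex 0 a, Complex b c))" for a b c
      by (simp add: h_def g_def)
    moreover have "octo_Im (h q) \<in> ?W" for q
      by (auto simp: h_def g_def z_def)
    ultimately show ?thesis
      unfolding z_def[symmetric] by auto
  qed
  moreover have span: "?W = span {x, y, z}"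
  proof (intro set_eqI iffI)
    fix w assume "w \<in> ?W"
    then obtain a b c where "w = a *\<^sub>R x + b *\<^sub>R y + c *\<^sub>R z"
      unfolding z_def by blast
    moreover have "x \<in> span {x, y, z}" "y \<in> span {x, y, z}" "z \<in> span {x, y, z}"
      by (simp_all add: span_base)
    ultimately show "w \<in> span {x, y, z}"
      by (simp add: span_add span_scale)
  next
    fix w assume "w \<in> span {x, y, z}"
    then obtain a b c where "w - a *\<^sub>R x - b *\<^sub>R y - c *\<^sub>R z = 0"
      by (auto simp: span_breakdown_eq)
    then have "w = a *\<^sub>R x + b *\<^sub>R y + c *\<^sub>R z" by (simp add: algebra_simps)
    then show "w \<in> ?W" unfolding z_def by blast
  qed
  moreover have "dim ?W = 3"
  proof -
    have nz: "x \<noteq> 0" "y \<noteq> 0" "z \<noteq> 0" "x \<noteq> y" "x \<noteq> z" "y \<noteq> z"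
      using tab by auto
    have "independent {x, y, z}"
      by (rule pairwise_orthogonal_independent)
        (use nz tab in \<open>auto simp: pairwise_def orthogonal_def\<close>)
    then have "dim {x, y, z} = card {x, y, z}" by (rule dim_eq_card_independent)
    then show ?thesis unfolding span using nz by simp
  qed
  ultimately show ?thesis
    unfolding associative_subspace_def by (metis subspace_span)
qed

lemma complexification_combinations:
  "complexification {a *\<^sub>R x + b *\<^sub>R y + c *\<^sub>R z | a b c. True} =
    {a *s cvec x + b *s cvec y + c *s cvec z | a b c. True}" (is "?L = ?R")
proof (intro set_eqI iffI)
  fix v assume "v \<in> ?L"
  then obtain a b c a' b' c' where "v = cvec (a *\<^sub>R x + b *\<^sub>R y + c *\<^sub>R z) +
      \<i> *s cvec (a' *\<^sub>R x + b' *\<^sub>R y + c' *\<^sub>R z)"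
    unfolding complexification_def by blast
  then have "v = Complex a a' *s cvec x + Complex b b' *s cvec y + Complex c c' *s cvec z"
    by (simp add: vec_eq_iff cvec_def complex_eq_iff)
  then show "v \<in> ?R" by blast
next
  fix v assume "v \<in> ?R"
  then obtain a b c where "v = a *s cvec x + b *s cvec y + c *s cvec z" by blast
  then have "v = cvec (Re a *\<^sub>R x + Re b *\<^sub>R y + Re c *\<^sub>R z) +
      \<i> *s cvec (Im a *\<^sub>R x + Im b *\<^sub>R y + Im c *\<^sub>R z)"
    by (simp add: vec_eq_iff cvec_def complex_eq_iff)
  then show "v \<in> ?L" unfolding complexification_def by blast
qed

section \<open>The three-space of an isotropic line\<close>

definition isotropic_span :: "complex^'n \<Rightarrow> complex^'n \<Rightarrow> (complex^'n) set"
  where "isotropic_span f s = {a *s cnj_vec s + b *s f + c *s s | a b c. True}"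

lemma isotropic_span_eq_spans:
  "{cnj_vec a + b + c | a b c. a \<in> vec.span {s} \<and> b \<in> vec.span {f} \<and> c \<in> vec.span {s}} =
    isotropic_span f s" (is "?L = ?R")
proof (intro set_eqI iffI)
  fix v assume "v \<in> ?L"
  then obtain a b c where "v = cnj_vec (a *s s) + b *s f + c *s s"
    by (auto simp: vec.span_singleton)
  then have "v = cnj a *s cnj_vec s + b *s f + c *s s"
    by (simp add: vec_eq_iff cnj_vec_def)
  then show "v \<in> ?R" unfolding isotropic_span_def by blast
next
  fix v assume "v \<in> ?R"
  then obtain a b c where "v = a *s cnj_vec s + b *s f + c *s s"
    unfolding isotropic_span_def by blast
  then have "v = cnj_vec (cnj a *s s) + b *s f + c *s s"
    by (simp add: vec_eq_iff cnj_vec_def)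
  moreover have "cnj a *s s \<in> vec.span {s}" "b *s f \<in> vec.span {f}" "c *s s \<in> vec.span {s}"
    by (auto simp: vec.span_singleton)
  ultimately show "v \<in> ?L" by blast
qed

text \<open>
  Write \<open>s = A + \<i> B\<close>. The eigenvalue equation says \<open>x \<times> A = - B\<close> and \<open>x \<times> B = A\<close>; hence \<open>A\<close> is
  orthogonal to \<open>x\<close>, and after normalising \<open>A\<close> to \<open>y\<close> the vectors \<open>x\<close>, \<open>y\<close> and \<open>x \<times> y\<close> span an
  associative subspace whose complexification is spanned by \<open>x\<close>, \<open>s\<close> and the conjugate of \<open>s\<close>.
\<close>
lemma isotropic_span_in_G2_SO4:
  assumes x: "x \<bullet> x = 1" and s: "vprod (cvec x) s = \<i> *s s" "s \<noteq> 0"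
  shows "isotropic_span (cvec x) s \<in> G2_SO4"
proof -
  define A B where "A = Re_vec s" and "B = Im_vec s"
  have sAB: "s = cvec A + \<i> *s cvec B"
    by (simp add: A_def B_def vec_eq_iff cvec_def Re_vec_def Im_vec_def complex_eq_iff)
  have "cvec (vprod x A) + \<i> *s cvec (vprod x B) = \<i> *s (cvec A + \<i> *s cvec B)"
    unfolding s(1)[symmetric] sAB[symmetric]
    by (simp add: sAB vec7_simps cvec_def complex_eq_iff)
  then have xA: "vprod x A = - B" and xB: "vprod x B = A"
    by (simp_all add: vec_eq_iff cvec_def complex_eq_iff)
  have "A \<noteq> 0"
  proof
    assume "A = 0"
    then have "B = 0" using xA by (simp add: vec7_simps)
    with \<open>A = 0\<close> show False using sAB s(2) by (simp add: vec_eq_iff cvec_def)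
  qed
  define r where "r = norm A"
  have r: "r \<noteq> 0" using \<open>A \<noteq> 0\<close> by (simp add: r_def)
  define y where "y = A /\<^sub>R r"
  have A: "A = r *\<^sub>R y" using r by (simp add: y_def)
  have B: "B = - r *\<^sub>R vprod x y"
    using xA by (simp add: A vprod_scaleR)
  have "x \<bullet> A = 0"
    unfolding xB[symmetric] by (simp add: bdot_vprod_self flip: bdot_eq_inner)
  then have xy: "x \<bullet> y = 0" using r by (simp add: A)
  have yy: "y \<bullet> y = 1"
    using r by (simp add: y_def r_def flip: power2_norm_eq_inner)
  let ?z = "vprod x y"
  let ?W = "{a *\<^sub>R x + b *\<^sub>R y + c *\<^sub>R ?z | a b c. True}"
  have sy: "s = of_real r *s cvec y - (\<i> * of_real r) *s cvec ?z"
    unfolding sAB by (simp add: A B vec_eq_iff cvec_def complex_eq_iff vprod_scaleR)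
  have "complexification ?W = isotropic_span (cvec x) s"
    unfolding complexification_combinations
  proof (intro set_eqI iffI)
    fix v assume "v \<in> {a *s cvec x + b *s cvec y + c *s cvec ?z | a b c. True}"
    then obtain a b c where v: "v = a *s cvec x + b *s cvec y + c *s cvec ?z" by blast
    have "v = ((b - \<i> * c) / (2 * of_real r)) *s cnj_vec s + a *s cvec x +
        ((b + \<i> * c) / (2 * of_real r)) *s s"
      unfolding v sy using r by (simp add: vec_eq_iff cvec_def cnj_vec_def field_simps)
    then show "v \<in> isotropic_span (cvec x) s" unfolding isotropic_span_def by blast
  next
    fix v assume "v \<in> isotropic_span (cvec x) s"
    then obtain a b c where v: "v = a *s cnj_vec s + b *s cvec x + c *s s"
      unfolding isotropic_span_def by blast
    have "v = b *s cvec x + (of_real r * (a + c)) *s cvec y + (\<i> * of_real r * (a - c)) *s cvec ?z"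
      unfolding v sy by (simp add: vec_eq_iff cvec_def cnj_vec_def algebra_simps)
    then show "v \<in> {a *s cvec x + b *s cvec y + c *s cvec ?z | a b c. True}" by blast
  qed
  then show ?thesis
    unfolding G2_SO4_def using associative_subspace_span[OF x yy xy] by blast
qed

definition outer :: "complex^'n \<Rightarrow> complex^'n \<Rightarrow> complex^'n^'n"
  where "outer u w = (\<chi> i j. u$i * w$j)"

lemma outer_apply: "outer u w *v v = bdot w v *s u"
  by (simp add: outer_def matrix_vector_mult_def bdot_def vec_eq_iff sum_distrib_left mult_ac)

text \<open>
  For \<open>s\<close> isotropic and orthogonal to the real unit vector \<open>f\<close>, the three lines are mutually
  orthogonal and the projection is the sum of the rank one projections. This explicit formula is
  what shows that the projection depends smoothly on the point.
\<close>
definition isotropic_proj :: "complex^'n \<Rightarrow> complex^'n \<Rightarrow> complex^'n^'n"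
  where "isotropic_proj f s =
    inverse (s \<bullet> s) *\<^sub>R (outer s (cnj_vec s) + outer (cnj_vec s) s) + outer f f"

lemma scaleR_matrix_vector: "(c *\<^sub>R A) *v v = c *\<^sub>R (A *v v)" for A :: "complex^'n^'m"
  by (simp add: matrix_vector_mult_def vec_eq_iff scaleR_sum_right)

lemma isotropic_proj_apply:
  "isotropic_proj f s *v v =
    inverse (s \<bullet> s) *\<^sub>R (bdot (cnj_vec s) v *s s + bdot s v *s cnj_vec s) + bdot f v *s f"
  by (simp add: isotropic_proj_def matrix_vector_mult_add_rdistrib scaleR_matrix_vector outer_apply)

lemma scaleR_eq_scale: "c *\<^sub>R v = complex_of_real c *s v" for v :: "complex^'n"
  unfolding vec_eq_iff vector_scaleR_component vector_smult_component
  by (simp add: scaleR_conv_of_real)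

lemma orthoproj_isotropic_proj:
  assumes f: "cnj_vec f = f" "bdot f f = 1" and s: "bdot s s = 0" "bdot f s = 0" "s \<noteq> 0"
  shows "orthoproj (isotropic_proj f s) (isotropic_span f s)"
  unfolding orthoproj_def
proof (intro allI conjI)
  fix v
  let ?N = "complex_of_real (s \<bullet> s)"
  have N: "?N \<noteq> 0" using s(3) by simp
  have ap: "isotropic_proj f s *v v = (bdot s v / ?N) *s cnj_vec s + bdot f v *s f
      + (bdot (cnj_vec s) v / ?N) *s s"
    by (simp add: isotropic_proj_apply scaleR_eq_scale vec_eq_iff field_simps)
  then show "isotropic_proj f s *v v \<in> isotropic_span f s"
    unfolding isotropic_span_def by blast
  have cs: "bdot (cnj_vec s) (cnj_vec s) = 0" "bdot f (cnj_vec s) = 0"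
  proof -
    have "bdot (cnj_vec a) (cnj_vec b) = cnj (bdot a b)" for a b :: "complex^'n"
      by (simp add: bdot_def cnj_vec_def)
    from this[of s s] this[of f s] show "bdot (cnj_vec s) (cnj_vec s) = 0" "bdot f (cnj_vec s) = 0"
      by (simp_all add: f s)
  qed
  have ss: "bdot s (cnj_vec s) = ?N" "bdot (cnj_vec s) s = ?N"
    using bdot_cnj_self[of s] by (simp_all add: bdot_commute[of "cnj_vec s" s])
  have sf: "bdot s f = 0" "bdot (cnj_vec s) f = 0"
    using cs s by (simp_all add: bdot_commute[of _ f])
  show "v - isotropic_proj f s *v v \<in> hperp (isotropic_span f s)"
    unfolding hperp_def isotropic_span_def
  proof (clarify)
    fix a b c
    have "cnj_vec (a *s cnj_vec s + b *s f + c *s s) = cnj a *s s + cnj b *s f + cnj c *s cnj_vec s"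
      using f(1) by (simp add: vec_eq_iff cnj_vec_def)
    then show "hermitian (v - isotropic_proj f s *v v) (a *s cnj_vec s + b *s f + c *s s) = 0"
      using N by (simp add: hermitian_eq_bdot ap bdot_simps s cs ss sf f
          bdot_commute[of v])
  qed
qed

lemma subspace_isotropic_span: "vec.subspace (isotropic_span f s)"
proof (rule vec.subspaceI)
  have "0 = 0 *s cnj_vec s + 0 *s f + 0 *s s" by simp
  then show "0 \<in> isotropic_span f s" unfolding isotropic_span_def by blast
next
  fix u v assume "u \<in> isotropic_span f s" "v \<in> isotropic_span f s"
  then obtain a b c a' b' c' where "u = a *s cnj_vec s + b *s f + c *s s"
    "v = a' *s cnj_vec s + b' *s f + c' *s s" unfolding isotropic_span_def by blast
  then have "u + v = (a + a') *s cnj_vec s + (b + b') *s f + (c + c') *s s"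
    by (simp add: vec_eq_iff algebra_simps)
  then show "u + v \<in> isotropic_span f s" unfolding isotropic_span_def by blast
next
  fix k u assume "u \<in> isotropic_span f s"
  then obtain a b c where "u = a *s cnj_vec s + b *s f + c *s s"
    unfolding isotropic_span_def by blast
  then have "k *s u = (k * a) *s cnj_vec s + (k * b) *s f + (k * c) *s s"
    by (simp add: vec_eq_iff algebra_simps)
  then show "k *s u \<in> isotropic_span f s" unfolding isotropic_span_def by blast
qed

section \<open>Partial derivatives\<close>

definition pd :: "'a::real_normed_vector \<Rightarrow> ('a \<Rightarrow> 'b::real_normed_vector) \<Rightarrow> 'a \<Rightarrow> 'b"
  where "pd h f x = frechet_derivative f (at x) h"

lemma smooth_on_pd: "smooth_on S f \<Longrightarrow> smooth_on S (pd h f)"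
  unfolding pd_def by (rule smooth_on_derivative)

lemma pd_eq: "(f has_derivative f') (at x) \<Longrightarrow> pd h f x = f' h"
  by (simp add: pd_def frechet_derivative_eq)

lemma pd_cong_open:
  assumes "open S" "x \<in> S" "\<And>y. y \<in> S \<Longrightarrow> f y = g y"
  shows "pd h f x = pd h g x"
  unfolding pd_def by (simp only: frechet_derivative_cong_open[OF assms])

lemma pd_const [simp]: "pd h (\<lambda>y. c) x = 0"
  by (simp add: pd_def)

lemma pd_bounded_linear:
  assumes "bounded_linear L" "f differentiable (at x)"
  shows "pd h (\<lambda>y. L (f y)) x = L (pd h f x)"
proof -
  have "(f has_derivative frechet_derivative f (at x)) (at x)"
    using assms(2) frechet_derivative_works by blast
  from pd_eq[OF bounded_linear.has_derivative[OF assms(1) this]] show ?thesis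
    by (simp add: pd_def)
qed

lemma pd_bounded_bilinear:
  assumes "bounded_bilinear B" "f differentiable (at x)" "g differentiable (at x)"
  shows "pd h (\<lambda>y. B (f y) (g y)) x = B (f x) (pd h g x) + B (pd h f x) (g x)"
proof -
  have f: "(f has_derivative frechet_derivative f (at x)) (at x)"
    and g: "(g has_derivative frechet_derivative g (at x)) (at x)"
    using assms(2,3) frechet_derivative_works by blast+
  from pd_eq[OF bounded_bilinear.FDERIV[OF assms(1) f g]] show ?thesis
    by (simp add: pd_def)
qed

lemma pd_add:
  assumes "f differentiable (at x)" "g differentiable (at x)"
  shows "pd h (\<lambda>y. f y + g y) x = pd h f x + pd h g x"
proof -
  have f: "(f has_derivative frechet_derivative f (at x)) (at x)"
    and g: "(g has_derivative frechet_derivative g (at x)) (at x)"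
    using assms frechet_derivative_works by blast+
  from pd_eq[OF has_derivative_add[OF f g]] show ?thesis
    by (simp add: pd_def)
qed

lemma pd_commute:
  fixes f :: "'a::real_normed_vector \<Rightarrow> 'b::euclidean_space"
  assumes "open S" "x \<in> S" "smooth_on S f"
  shows "pd v (pd u f) x = pd u (pd v f) x"
  using second_derivative_symmetric[OF assms] unfolding pd_def .

lemma smooth_on_bounded_linear:
  "bounded_linear L \<Longrightarrow> open S \<Longrightarrow> smooth_on S f \<Longrightarrow> smooth_on S (\<lambda>x. L (f x))"
  unfolding smooth_on_def by (blast intro: Ck_on_bounded_linear)

lemma smooth_on_bounded_bilinear:
  "bounded_bilinear B \<Longrightarrow> open S \<Longrightarrow> smooth_on S f \<Longrightarrow> smooth_on S g \<Longrightarrow>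
    smooth_on S (\<lambda>x. B (f x) (g x))"
  unfolding smooth_on_def by (blast intro: Ck_on_bounded_bilinear)

lemma smooth_on_add:
  "open S \<Longrightarrow> smooth_on S f \<Longrightarrow> smooth_on S g \<Longrightarrow> smooth_on S (\<lambda>x. f x + g x)"
  unfolding smooth_on_def by (blast intro: Ck_on_add)

lemma smooth_on_const: "smooth_on S (\<lambda>x. c)"
  unfolding smooth_on_def by (blast intro: Ck_on_const)

lemma smooth_on_inverse:
  fixes f :: "'a::real_normed_vector \<Rightarrow> real"
  shows "open S \<Longrightarrow> (\<And>x. x \<in> S \<Longrightarrow> f x \<noteq> 0) \<Longrightarrow> smooth_on S f \<Longrightarrow>
    smooth_on S (\<lambda>x. inverse (f x))"
  unfolding smooth_on_def by (blast intro: Ck_on_inverse)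

lemma bounded_linear_cvec: "bounded_linear cvec"
  unfolding linear_conv_bounded_linear[symmetric]
  by (rule linearI) (simp_all add: cvec_def vec_eq_iff complex_eq_iff)

lemma bounded_linear_cnj_vec: "bounded_linear cnj_vec"
  unfolding linear_conv_bounded_linear[symmetric]
  by (rule linearI) (simp_all add: cnj_vec_def vec_eq_iff complex_eq_iff)

lemma bounded_linear_vec_scale: "bounded_linear (\<lambda>v::complex^'n. c *s v)"
  unfolding linear_conv_bounded_linear[symmetric]
  by (rule linearI) (simp_all add: vec_eq_iff algebra_simps)

lemma bounded_bilinear_matrix_vector:
  "bounded_bilinear (\<lambda>(A::complex^'n^'m) v. A *v v)"
  unfolding bilinear_conv_bounded_bilinear[symmetric] bilinear_def
  by (auto intro!: linearI simp: matrix_vector_mult_add_rdistrib scaleR_matrix_vector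
      matrix_vector_right_distrib)

lemma bounded_bilinear_bdot: "bounded_bilinear (bdot :: complex^'n \<Rightarrow> _)"
  unfolding bilinear_conv_bounded_bilinear[symmetric] bilinear_def
  by (auto intro!: linearI simp: bdot_simps scaleR_eq_scale scaleR_conv_of_real)

lemma bounded_bilinear_outer: "bounded_bilinear (outer :: complex^'n \<Rightarrow> _)"
  unfolding bilinear_conv_bounded_bilinear[symmetric] bilinear_def
  by (auto intro!: linearI simp: outer_def vec_eq_iff algebra_simps)

lemma bounded_bilinear_vprod_real: "bounded_bilinear (vprod :: real^7 \<Rightarrow> _)"
  unfolding bilinear_conv_bounded_bilinear[symmetric] bilinear_def
  by (auto intro!: linearI simp: vprod_add_left vprod_add_right vprod_scaleR)

lemma bounded_bilinear_vprod_complex: "bounded_bilinear (vprod :: complex^7 \<Rightarrow> _)"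
  unfolding bilinear_conv_bounded_bilinear[symmetric] bilinear_def
  by (auto intro!: linearI simp: vprod_add_left vprod_add_right vprod_scale_left vprod_scale_right
      scaleR_eq_scale)

section \<open>Wirtinger derivatives\<close>

text \<open>
  The derivatives by \<open>z\<close> and by the conjugate coordinate are the cases \<open>c = - \<i>\<close> and \<open>c = \<i>\<close>. They are
  treated together because the product rule is the same for both.
\<close>
definition wirt :: "complex \<Rightarrow> (complex \<Rightarrow> complex^'n) \<Rightarrow> complex \<Rightarrow> complex^'n"
  where "wirt c g x = (1/2) *s (pd 1 g x + c *s pd \<i> g x)"

text \<open>
  The corresponding derivative of a matrix-valued function, as an operator on vectors.
\<close>
definition wirt_mat ::
    "complex \<Rightarrow> (complex \<Rightarrow> complex^'n^'n) \<Rightarrow> complex \<Rightarrow> complex^'n \<Rightarrow> complex^'n"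
  where "wirt_mat c P x w = (1/2) *s (pd 1 P x *v w + c *s (pd \<i> P x *v w))"

lemma wirt_cong_open:
  assumes "open S" "x \<in> S" "\<And>y. y \<in> S \<Longrightarrow> f y = g y"
  shows "wirt c f x = wirt c g x"
  unfolding wirt_def by (simp only: pd_cong_open[OF assms])

lemma smooth_on_wirt: "open S \<Longrightarrow> smooth_on S g \<Longrightarrow> smooth_on S (wirt c g)"
  unfolding wirt_def[abs_def]
  by (intro smooth_on_bounded_linear[OF bounded_linear_vec_scale] smooth_on_add smooth_on_pd)

lemma wirt_mat_add: "wirt_mat c P x (v + w) = wirt_mat c P x v + wirt_mat c P x w"
  by (simp add: wirt_mat_def matrix_vector_right_distrib vec.scale_right_distrib)

lemma wirt_mat_scale: "wirt_mat c P x (k *s w) = k *s wirt_mat c P x w"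
  by (simp add: wirt_mat_def vector_scalar_commute vec.scale_right_distrib mult.commute)

lemma wirt_mat_zero [simp]: "wirt_mat c P x 0 = 0"
  by (simp add: wirt_mat_def)

lemma wirt_matrix_vector:
  assumes "P differentiable (at x)" "g differentiable (at x)"
  shows "wirt c (\<lambda>y. P y *v g y) x = wirt_mat c P x (g x) + P x *v wirt c g x"
  by (simp add: wirt_def wirt_mat_def pd_bounded_bilinear[OF bounded_bilinear_matrix_vector assms]
      matrix_vector_right_distrib vector_scalar_commute vec.scale_right_distrib)

lemma wirt_bdot_const:
  assumes S: "open S" "x \<in> S" and "u differentiable (at x)" "v differentiable (at x)"
    and k: "\<And>y. y \<in> S \<Longrightarrow> bdot (u y) (v y) = k"
  shows "bdot (u x) (wirt c v x) + bdot (wirt c u x) (v x) = 0"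
proof -
  have "bdot (u x) (pd h v x) + bdot (pd h u x) (v x) = 0" for h
    using pd_bounded_bilinear[OF bounded_bilinear_bdot assms(3,4), of h]
      pd_cong_open[OF S, of "\<lambda>y. bdot (u y) (v y)" "\<lambda>y. k" h] k
    by simp
  from this[of 1] this[of \<i>] show ?thesis
    by (simp add: wirt_def bdot_simps) algebra
qed

lemma wirt_eigenvector:
  assumes S: "open S" "x \<in> S" and d: "u differentiable (at x)" "v differentiable (at x)"
    and k: "\<And>y. y \<in> S \<Longrightarrow> vprod (u y) (v y) = k *s v y"
  shows "vprod (u x) (wirt c v x) + vprod (wirt c u x) (v x) = k *s wirt c v x"
proof -
  have h: "vprod (u x) (pd h v x) + vprod (pd h u x) (v x) = k *s pd h v x" for h
    using pd_bounded_bilinear[OF bounded_bilinear_vprod_complex d, of h]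
      pd_cong_open[OF S, of "\<lambda>y. vprod (u y) (v y)" "\<lambda>y. k *s v y" h] k
      pd_bounded_linear[OF bounded_linear_vec_scale d(2), of h k]
    by simp
  have "vprod (u x) (wirt c v x) + vprod (wirt c u x) (v x) =
      (1/2) *s ((vprod (u x) (pd 1 v x) + vprod (pd 1 u x) (v x))
        + c *s (vprod (u x) (pd \<i> v x) + vprod (pd \<i> u x) (v x)))"
    by (simp add: wirt_def vprod_add_left vprod_add_right vprod_scale_left vprod_scale_right
        vec_eq_iff algebra_simps)
  also have "\<dots> = k *s wirt c v x"
    unfolding h by (simp add: wirt_def vec_eq_iff algebra_simps)
  finally show ?thesis .
qed

section \<open>Adapted frames\<close>

lemma cnj_vec_simps:
  "cnj_vec (u + v) = cnj_vec u + cnj_vec v" "cnj_vec (u - v) = cnj_vec u - cnj_vec v"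
  "cnj_vec (c *s u) = cnj c *s cnj_vec u" "cnj_vec 0 = 0"
  by (simp_all add: cnj_vec_def vec_eq_iff)

lemma vprod_diff_right: "vprod w (u - v) = vprod w u - vprod w v"
  using vprod_add_right[of w "u - v" v] by simp

lemma bdot_cnj_vec: "bdot (cnj_vec u) (cnj_vec v) = cnj (bdot u v)"
  by (simp add: bdot_def cnj_vec_def)

text \<open>Skewness of \<open>u \<mapsto> f \<times> u\<close> gives \<open>\<i> (u, v) = - \<i> (u, v)\<close>.\<close>
lemma eigenvectors_bdot_zero:
  fixes f u v :: "complex^7"
  assumes "vprod f u = \<i> *s u" "vprod f v = \<i> *s v"
  shows "bdot u v = 0"
  using bdot_vprod_skew[of f u v] by (simp add: assms vprod_swap[of u f] bdot_simps)

lemma eigenvector_bdot_zero: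
  fixes f u :: "complex^7"
  assumes "vprod f u = \<i> *s u"
  shows "bdot f u = 0"
  using bdot_vprod_self[of f u] by (simp add: assms bdot_simps)

text \<open>
  The data in a coordinate domain: \<open>F\<close> in the coordinate, and a section \<open>s\<close> spanning the line bundle.
  As multiplication by \<open>\<i>\<close> sends the coordinate direction \<open>1\<close> to \<open>\<i>\<close>, the map \<open>F\<close> is almost complex as
  soon as its derivatives in these two directions are related by the vector product. The last
  assumption is the holomorphy of the line bundle: projecting along \<open>F\<close> turns the conjugate
  derivative of \<open>s\<close> into a multiple of \<open>s\<close>.
\<close>
locale adapted_frame =
  fixes S :: "complex set" and F :: "complex \<Rightarrow> real^7" and s :: "complex \<Rightarrow> complex^7"
  assumes open_S: "open S"
    and smooth_F: "smooth_on S F" and smooth_s: "smooth_on S s"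
    and norm_F: "x \<in> S \<Longrightarrow> F x \<bullet> F x = 1"
    and almost_complex: "x \<in> S \<Longrightarrow> pd \<i> F x = vprod (F x) (pd 1 F x)"
    and vprod_F_s: "x \<in> S \<Longrightarrow> vprod (cvec (F x)) (s x) = \<i> *s s x"
    and s_nonzero: "x \<in> S \<Longrightarrow> s x \<noteq> 0"
    and dbar_s: "x \<in> S \<Longrightarrow> \<exists>a b. wirt \<i> s x = a *s s x + b *s cvec (F x)"
begin

definition "f x = cvec (F x)"
definition "P x = isotropic_proj (f x) (s x)"

lemma smooth_f: "smooth_on S f"
  unfolding f_def[abs_def] by (rule smooth_on_bounded_linear[OF bounded_linear_cvec open_S smooth_F])

lemma smooth_cs: "smooth_on S (\<lambda>x. cnj_vec (s x))"
  by (rule smooth_on_bounded_linear[OF bounded_linear_cnj_vec open_S smooth_s])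

lemma smooth_P: "smooth_on S P"
proof -
  have "smooth_on S (\<lambda>x. inverse (s x \<bullet> s x))"
    by (rule smooth_on_inverse[OF open_S])
      (use s_nonzero smooth_on_bounded_bilinear[OF bounded_bilinear_inner open_S smooth_s smooth_s]
        in simp_all)
  then show ?thesis
    unfolding P_def[abs_def] isotropic_proj_def
    by (rule smooth_on_add[OF open_S smooth_on_bounded_bilinear[OF bounded_bilinear_scaleR open_S _
          smooth_on_add[OF open_S smooth_on_bounded_bilinear[OF bounded_bilinear_outer open_S
            smooth_s smooth_cs] smooth_on_bounded_bilinear[OF bounded_bilinear_outer open_S
            smooth_cs smooth_s]]] smooth_on_bounded_bilinear[OF bounded_bilinear_outer open_S
            smooth_f smooth_f]])
qed

lemmas diff_f = smooth_on_differentiable[OF smooth_f]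
lemmas diff_s = smooth_on_differentiable[OF smooth_s]
lemmas diff_P = smooth_on_differentiable[OF smooth_P]
lemmas diff_F = smooth_on_differentiable[OF smooth_F]

lemma cnj_f [simp]: "cnj_vec (f x) = f x"
  by (simp add: f_def)

lemma bdot_f_f: "x \<in> S \<Longrightarrow> bdot (f x) (f x) = 1"
  by (simp add: f_def bdot_cvec norm_F)

lemma vprod_f_s: "x \<in> S \<Longrightarrow> vprod (f x) (s x) = \<i> *s s x"
  by (simp add: f_def vprod_F_s)

lemma bdot_s_s: "x \<in> S \<Longrightarrow> bdot (s x) (s x) = 0"
  using eigenvectors_bdot_zero[OF vprod_f_s vprod_f_s] .

lemma bdot_f_s: "x \<in> S \<Longrightarrow> bdot (f x) (s x) = 0"
  using eigenvector_bdot_zero[OF vprod_f_s] .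

lemma orthoproj_P: "x \<in> S \<Longrightarrow> orthoproj (P x) (isotropic_span (f x) (s x))"
  unfolding P_def by (rule orthoproj_isotropic_proj[OF cnj_f bdot_f_f bdot_s_s bdot_f_s s_nonzero])

lemma P_apply:
  "P x *v v = inverse (s x \<bullet> s x) *\<^sub>R (bdot (cnj_vec (s x)) v *s s x + bdot (s x) v *s cnj_vec (s x))
    + bdot (f x) v *s f x"
  by (simp add: P_def isotropic_proj_apply)

lemma P_fixes:
  assumes "x \<in> S"
  shows "P x *v (a *s cnj_vec (s x) + b *s f x + c *s s x) = a *s cnj_vec (s x) + b *s f x + c *s s x"
  by (rule orthoproj_apply[OF subspace_isotropic_span orthoproj_P[OF assms]])
    (auto simp: isotropic_span_def)

lemma P_s: "x \<in> S \<Longrightarrow> P x *v s x = s x"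
  using P_fixes[of x 0 0 1] by simp

lemma P_f: "x \<in> S \<Longrightarrow> P x *v f x = f x"
  using P_fixes[of x 0 1 0] by simp

lemma P_cs: "x \<in> S \<Longrightarrow> P x *v cnj_vec (s x) = cnj_vec (s x)"
  using P_fixes[of x 1 0 0] by simp

lemma P_range: "x \<in> S \<Longrightarrow> \<exists>a b c. P x *v v = a *s cnj_vec (s x) + b *s f x + c *s s x"
  using orthoproj_P[of x] unfolding orthoproj_def isotropic_span_def by blast

lemma P_P: "x \<in> S \<Longrightarrow> P x *v (P x *v v) = P x *v v"
  using P_range[of x v] P_fixes[of x] by auto

lemma P_symmetric: "bdot u (P x *v v) = bdot (P x *v u) v"
  by (simp add: P_apply bdot_simps scaleR_eq_scale bdot_commute[of _ "s x"] bdot_commute[of _ "f x"]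
      bdot_commute[of _ "cnj_vec (s x)"] algebra_simps)

lemma P_real: "cnj_vec (P x *v v) = P x *v cnj_vec v"
proof -
  have "bdot (s x) (cnj_vec v) = cnj (bdot (cnj_vec (s x)) v)"
    "bdot (cnj_vec (s x)) (cnj_vec v) = cnj (bdot (s x) v)"
    "bdot (f x) (cnj_vec v) = cnj (bdot (f x) v)"
    using bdot_cnj_vec[of "cnj_vec (s x)" v] bdot_cnj_vec[of "s x" v] bdot_cnj_vec[of "f x" v]
    by simp_all
  then show ?thesis
    by (simp add: P_apply cnj_vec_simps scaleR_eq_scale add.commute)
qed

text \<open>
  A vector of the three-space is determined by its dot products with the frame; this is how the
  compositions of derivatives of \<open>P\<close> are evaluated.
\<close>
lemma fixed_eq_0:
  assumes "x \<in> S" "P x *v u = u" "bdot (s x) u = 0" "bdot (f x) u = 0" "bdot (cnj_vec (s x)) u = 0"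
  shows "u = 0"
  using assms(2) unfolding P_apply assms(3-5) by simp

text \<open>
  The coefficient of the conjugate of \<open>s\<close> in \<open>P v\<close> is proportional to the product of \<open>v\<close> with \<open>s\<close>
  itself.
\<close>
lemma P_isotropic:
  assumes "bdot (s x) v = 0" "bdot (f x) v = 0"
  shows "\<exists>a. P x *v v = a *s s x"
  unfolding P_apply assms by (auto simp: scaleR_eq_scale)

abbreviation "N c x w \<equiv> wirt_mat c P x w"

lemma pd_P_apply: "x \<in> S \<Longrightarrow> pd h (\<lambda>y. P y *v w) x = pd h P x *v w"
  using pd_bounded_bilinear[OF bounded_bilinear_matrix_vector diff_P, of x "\<lambda>y. w" h] by simp

text \<open>The derivative of \<open>P P = P\<close>: the derivative of \<open>P\<close> exchanges the range and the kernel of \<open>P\<close>.\<close>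
lemma N_P:
  assumes x: "x \<in> S"
  shows "N c x (P x *v w) + P x *v N c x w = N c x w"
proof -
  have d: "(\<lambda>y. P y *v w) differentiable (at x)"
    by (rule smooth_on_differentiable[OF smooth_on_bounded_bilinear[OF bounded_bilinear_matrix_vector
          open_S smooth_P smooth_on_const] x])
  have w: "wirt c (\<lambda>y. P y *v w) x = N c x w"
    unfolding wirt_def wirt_mat_def by (simp add: pd_P_apply[OF x])
  have "wirt c (\<lambda>y. P y *v (P y *v w)) x = N c x (P x *v w) + P x *v N c x w"
    using wirt_matrix_vector[OF diff_P[OF x] d, of c] w by simp
  moreover have "wirt c (\<lambda>y. P y *v (P y *v w)) x = wirt c (\<lambda>y. P y *v w) x"
    by (rule wirt_cong_open[OF open_S x P_P])
  ultimately show ?thesis using w by simp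
qed

lemma P_N_fixed: "x \<in> S \<Longrightarrow> P x *v w = w \<Longrightarrow> P x *v N c x w = 0"
  using N_P[of x c w] by simp

lemma P_N_kernel: "x \<in> S \<Longrightarrow> P x *v w = 0 \<Longrightarrow> P x *v N c x w = N c x w"
  using N_P[of x c w] by simp

text \<open>
  On sections of the three-space bundle the derivative of \<open>P\<close> is the second fundamental form.
\<close>
lemma N_invariant_section:
  assumes x: "x \<in> S" and g: "smooth_on S g" and fixed: "\<And>y. y \<in> S \<Longrightarrow> P y *v g y = g y"
  shows "N c x (g x) = wirt c g x - P x *v wirt c g x"
proof -
  have "wirt c (\<lambda>y. P y *v g y) x = wirt c g x"
    by (rule wirt_cong_open[OF open_S x fixed])
  then show ?thesis
    using wirt_matrix_vector[OF diff_P[OF x] smooth_on_differentiable[OF g x], of c]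
    by (simp add: algebra_simps)
qed

lemma pd_P_symmetric:
  assumes x: "x \<in> S"
  shows "bdot u (pd h P x *v v) = bdot (pd h P x *v u) v"
proof -
  have d: "(\<lambda>y. P y *v w) differentiable (at x)" for w
    by (rule smooth_on_differentiable[OF smooth_on_bounded_bilinear[OF bounded_bilinear_matrix_vector
          open_S smooth_P smooth_on_const] x])
  have "pd h (\<lambda>y. bdot u (P y *v v)) x = bdot u (pd h P x *v v)"
    using pd_bounded_bilinear[OF bounded_bilinear_bdot _ d, where f = "\<lambda>y. u" and h = h] pd_P_apply[OF x] by simp
  moreover have "pd h (\<lambda>y. bdot (P y *v u) v) x = bdot (pd h P x *v u) v"
    using pd_bounded_bilinear[OF bounded_bilinear_bdot d, where g = "\<lambda>y. v" and h = h] pd_P_apply[OF x] by simp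
  ultimately show ?thesis by (simp add: P_symmetric)
qed

lemma N_symmetric: "x \<in> S \<Longrightarrow> bdot u (N c x v) = bdot (N c x u) v"
  by (simp add: wirt_mat_def bdot_simps pd_P_symmetric)

lemma pd_P_real:
  assumes x: "x \<in> S"
  shows "cnj_vec (pd h P x *v v) = pd h P x *v cnj_vec v"
proof -
  have d: "(\<lambda>y. P y *v v) differentiable (at x)"
    by (rule smooth_on_differentiable[OF smooth_on_bounded_bilinear[OF bounded_bilinear_matrix_vector
          open_S smooth_P smooth_on_const] x])
  have "pd h (\<lambda>y. cnj_vec (P y *v v)) x = cnj_vec (pd h P x *v v)"
    using pd_bounded_linear[OF bounded_linear_cnj_vec d] pd_P_apply[OF x] by simp
  then show ?thesis using pd_P_apply[OF x] by (simp add: P_real)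
qed

lemma N_real: "x \<in> S \<Longrightarrow> cnj_vec (N c x v) = N (cnj c) x (cnj_vec v)"
  by (simp add: wirt_mat_def cnj_vec_simps pd_P_real)

subsection \<open>First derivatives of the frame\<close>

lemma pd_f: "x \<in> S \<Longrightarrow> pd h f x = cvec (pd h F x)"
  unfolding f_def[abs_def] by (rule pd_bounded_linear[OF bounded_linear_cvec diff_F])

lemma F_pd_F:
  assumes x: "x \<in> S"
  shows "F x \<bullet> pd h F x = 0"
proof -
  have "pd h (\<lambda>y. F y \<bullet> F y) x = 0"
    using pd_cong_open[OF open_S x, of "\<lambda>y. F y \<bullet> F y" "\<lambda>y. 1" h] norm_F by simp
  then show ?thesis
    using pd_bounded_bilinear[OF bounded_bilinear_inner diff_F[OF x] diff_F[OF x], of h]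
    by (simp add: inner_commute)
qed

lemma vprod_F_pd_i: "x \<in> S \<Longrightarrow> vprod (F x) (pd \<i> F x) = - pd 1 F x"
  by (simp add: almost_complex vprod_vprod_left bdot_eq_inner F_pd_F norm_F)

lemma wirt_f_real: "x \<in> S \<Longrightarrow> cnj_vec (wirt c f x) = wirt (cnj c) f x"
  by (simp add: wirt_def pd_f cnj_vec_simps)

lemma vprod_cvec: "vprod (cvec a) (cvec b) = cvec (vprod a b)"
  by (simp add: vec7_simps cvec_def)

text \<open>
  The derivative of an almost complex map by \<open>z\<close> is of type \<open>(1,0)\<close>.
\<close>
lemma vprod_f_fz:
  assumes x: "x \<in> S"
  shows "vprod (f x) (wirt (- \<i>) f x) = \<i> *s wirt (- \<i>) f x"
  by (simp add: wirt_def pd_f[OF x] vprod_scale_left vprod_scale_right vprod_add_right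
      vprod_diff_right f_def
      vprod_cvec vprod_F_pd_i[OF x] almost_complex[OF x, symmetric])
    (simp add: cvec_def vec_eq_iff algebra_simps)

lemma bdot_f_fz: "x \<in> S \<Longrightarrow> bdot (f x) (wirt (- \<i>) f x) = 0"
  by (rule eigenvector_bdot_zero[OF vprod_f_fz])

lemma bdot_s_fz: "x \<in> S \<Longrightarrow> bdot (s x) (wirt (- \<i>) f x) = 0"
  by (rule eigenvectors_bdot_zero[OF vprod_f_s vprod_f_fz])

lemma bdot_fz_fz: "x \<in> S \<Longrightarrow> bdot (wirt (- \<i>) f x) (wirt (- \<i>) f x) = 0"
  by (rule eigenvectors_bdot_zero[OF vprod_f_fz vprod_f_fz])

lemma bdot_s_sz: "x \<in> S \<Longrightarrow> bdot (s x) (wirt c s x) = 0"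
  using wirt_bdot_const[OF open_S _ diff_s diff_s bdot_s_s, of x c]
  by (simp add: bdot_commute[of "wirt c s x" "s x"])

lemma bdot_f_sz: "x \<in> S \<Longrightarrow> bdot (f x) (wirt (- \<i>) s x) = 0"
  using wirt_bdot_const[OF open_S _ diff_f diff_s bdot_f_s, of x "- \<i>"] bdot_s_fz[of x]
  by (simp add: bdot_commute[of "wirt (- \<i>) f x"])

text \<open>
  Pair the derivative \<open>f \<times> s\<^sub>z + f\<^sub>z \<times> s = \<i> s\<^sub>z\<close> of the eigenvalue equation with \<open>f\<^sub>z\<close>: the middle
  term drops out and skewness turns the first into \<open>- \<i> (f\<^sub>z, s\<^sub>z)\<close>.
\<close>
lemma bdot_fz_sz:
  assumes x: "x \<in> S"
  shows "bdot (wirt (- \<i>) f x) (wirt (- \<i>) s x) = 0"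
proof -
  let ?u = "wirt (- \<i>) f x" and ?v = "wirt (- \<i>) s x"
  have "bdot ?u (vprod (f x) ?v) + bdot ?u (vprod ?u (s x)) = \<i> * bdot ?u ?v"
    using arg_cong[OF wirt_eigenvector[OF open_S x diff_f[OF x] diff_s[OF x] vprod_f_s, of "- \<i>"],
        of "bdot ?u"] by (simp add: bdot_simps)
  moreover have "bdot ?u (vprod (f x) ?v) = - \<i> * bdot ?u ?v"
    using bdot_vprod_skew[of "f x" ?u ?v] by (simp add: vprod_f_fz[OF x] bdot_simps)
  ultimately show ?thesis by (simp add: bdot_vprod_self)
qed

lemma P_fz: "x \<in> S \<Longrightarrow> \<exists>a. P x *v wirt (- \<i>) f x = a *s s x"
  by (rule P_isotropic[OF bdot_s_fz bdot_f_fz])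

lemma P_sz: "x \<in> S \<Longrightarrow> \<exists>a. P x *v wirt (- \<i>) s x = a *s s x"
  by (rule P_isotropic[OF bdot_s_sz bdot_f_sz])

lemma P_szbar: "x \<in> S \<Longrightarrow> P x *v wirt \<i> s x = wirt \<i> s x"
  using dbar_s[of x] P_fixes[of x 0] by (auto simp: f_def add.commute)

lemma N_s: "x \<in> S \<Longrightarrow> N c x (s x) = wirt c s x - P x *v wirt c s x"
  by (rule N_invariant_section[OF _ smooth_s P_s])

lemma N_f: "x \<in> S \<Longrightarrow> N c x (f x) = wirt c f x - P x *v wirt c f x"
  by (rule N_invariant_section[OF _ smooth_f P_f])

lemma N_i_s: "x \<in> S \<Longrightarrow> N \<i> x (s x) = 0"
  by (simp add: N_s P_szbar)

lemma N_cs: "x \<in> S \<Longrightarrow> N (- \<i>) x (cnj_vec (s x)) = 0"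
  using N_real[of x \<i> "s x"] by (simp add: N_i_s cnj_vec_simps)

subsection \<open>Nilpotency\<close>

text \<open>
  \<open>N f\<close> and \<open>N s\<close> differ from \<open>f\<^sub>z\<close> and \<open>s\<^sub>z\<close> by multiples of \<open>s\<close>, and \<open>f\<^sub>z\<close> is orthogonal to \<open>f\<^sub>z\<close>, \<open>s\<^sub>z\<close>
  and \<open>s\<close>. So \<open>N f\<close> is orthogonal to \<open>N s\<close>, \<open>N f\<close> and \<open>N (cnj s) = 0\<close>, and symmetry of \<open>N\<close> applies.
\<close>
lemma N_N_f:
  assumes x: "x \<in> S"
  shows "N (- \<i>) x (N (- \<i>) x (f x)) = 0"
proof -
  let ?N = "N (- \<i>) x"
  obtain a where a: "P x *v wirt (- \<i>) f x = a *s s x" using P_fz[OF x] by blast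
  obtain b where b: "P x *v wirt (- \<i>) s x = b *s s x" using P_sz[OF x] by blast
  have Nf: "?N (f x) = wirt (- \<i>) f x - a *s s x" and Ns: "?N (s x) = wirt (- \<i>) s x - b *s s x"
    by (simp_all add: N_f N_s x a b)
  have "P x *v ?N (f x) = 0" by (rule P_N_fixed[OF x P_f[OF x]])
  then have "P x *v ?N (?N (f x)) = ?N (?N (f x))" by (rule P_N_kernel[OF x])
  moreover have "bdot (s x) (?N (?N (f x))) = 0"
    unfolding N_symmetric[OF x, of "s x"] Nf Ns using bdot_s_sz[OF x, of "- \<i>"]
    by (simp add: bdot_simps bdot_s_fz[OF x] bdot_s_s[OF x] bdot_fz_sz[OF x]
        bdot_commute[of "wirt (- \<i>) s x" "s x"]
        bdot_commute[of "wirt (- \<i>) s x" "wirt (- \<i>) f x"])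
  moreover have "bdot (f x) (?N (?N (f x))) = 0"
    unfolding N_symmetric[OF x, of "f x"] Nf
    by (simp add: bdot_simps bdot_s_fz[OF x] bdot_s_s[OF x] bdot_fz_fz[OF x]
        bdot_commute[of "wirt (- \<i>) f x" "s x"])
  moreover have "bdot (cnj_vec (s x)) (?N (?N (f x))) = 0"
    unfolding N_symmetric[OF x, of "cnj_vec (s x)"] by (simp add: N_cs[OF x])
  ultimately show ?thesis by (rule fixed_eq_0[OF x])
qed

text \<open>
  By symmetry of \<open>N\<close>, the products of \<open>N N s\<close> with \<open>f\<close> and \<open>cnj s\<close> are those of \<open>s\<close> with \<open>N N f = 0\<close> and of
  \<open>N s\<close> with \<open>N (cnj s) = 0\<close>. The component that remains is along \<open>cnj s\<close>, which \<open>N\<close> annihilates.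
\<close>
lemma N_N_s:
  assumes x: "x \<in> S"
  shows "\<exists>k. N (- \<i>) x (N (- \<i>) x (s x)) = k *s cnj_vec (s x)"
proof -
  let ?N = "N (- \<i>) x"
  have "P x *v ?N (s x) = 0" by (rule P_N_fixed[OF x P_s[OF x]])
  then have "P x *v ?N (?N (s x)) = ?N (?N (s x))" by (rule P_N_kernel[OF x])
  moreover have "bdot (f x) (?N (?N (s x))) = 0"
  proof -
    have "bdot (f x) (?N (?N (s x))) = bdot (?N (?N (f x))) (s x)"
      by (simp only: N_symmetric[OF x])
    then show ?thesis by (simp add: N_N_f[OF x])
  qed
  moreover have "bdot (cnj_vec (s x)) (?N (?N (s x))) = 0"
    unfolding N_symmetric[OF x, of "cnj_vec (s x)"] by (simp add: N_cs[OF x])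
  ultimately have "?N (?N (s x)) =
      inverse (s x \<bullet> s x) *\<^sub>R (bdot (s x) (?N (?N (s x))) *s cnj_vec (s x))"
    using P_apply[of x "?N (?N (s x))"] by simp
  then show ?thesis unfolding scaleR_eq_scale vec.scale_scale by blast
qed

text \<open>\<open>J\<close> is \<open>\<iota>\<close> in the coordinate, and \<open>A\<close> below is the operator of \<open>A\<^sub>z\<close>.\<close>
definition "J x = P x - (mat 1 - P x)"

lemma J_apply: "J x *v v = 2 *s (P x *v v) - v"
  unfolding J_def matrix_vector_mult_diff_rdistrib matrix_vector_mul_lid
  by (simp add: vec_eq_iff)

definition "A x w = J x *v N (- \<i>) x w"

lemma A_linear: "A x (v + w) = A x v + A x w" "A x (k *s w) = k *s A x w"
  by (simp_all add: A_def wirt_mat_add wirt_mat_scale matrix_vector_right_distrib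
      vector_scalar_commute)

lemma A_zero [simp]: "A x 0 = 0"
  using A_linear(2)[of x 0 0] by simp

lemma A_minus: "A x (- v) = - A x v"
  using A_linear(1)[of x v "- v"] by (simp add: eq_neg_iff_add_eq_0 add.commute)

lemma A_fixed: "x \<in> S \<Longrightarrow> P x *v w = w \<Longrightarrow> A x w = - N (- \<i>) x w"
  by (simp add: A_def J_apply P_N_fixed)

lemma A_kernel: "x \<in> S \<Longrightarrow> P x *v w = 0 \<Longrightarrow> A x w = N (- \<i>) x w"
  by (simp add: A_def J_apply P_N_kernel) (simp add: vec_eq_iff)

lemma A_A_fixed:
  assumes x: "x \<in> S" and w: "P x *v w = w"
  shows "A x (A x w) = - N (- \<i>) x (N (- \<i>) x w)"
proof -
  have "A x (N (- \<i>) x w) = N (- \<i>) x (N (- \<i>) x w)"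
    by (rule A_kernel[OF x P_N_fixed[OF x w]])
  then show ?thesis by (simp add: A_fixed[OF x w] A_minus)
qed

lemma A_power4_fixed:
  assumes x: "x \<in> S"
  shows "A x (A x (A x (A x (P x *v v)))) = 0"
proof -
  obtain a b c where v: "P x *v v = a *s cnj_vec (s x) + b *s f x + c *s s x"
    using P_range[OF x] by blast
  have cs: "A x (A x (cnj_vec (s x))) = 0"
    using x by (simp add: A_A_fixed P_cs N_cs)
  have "A x (A x (f x)) = 0"
    using x by (simp add: A_A_fixed P_f N_N_f)
  moreover obtain k where "A x (A x (s x)) = (- k) *s cnj_vec (s x)"
    using x N_N_s[OF x] by (auto simp: A_A_fixed P_s)
  ultimately show ?thesis
    unfolding v A_linear using cs by (simp add: A_linear A_minus)
qed

lemma A_nilpotent: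
  assumes x: "x \<in> S"
  shows "A x (A x (A x (A x (A x v)))) = 0"
proof -
  define w where "w = v - P x *v v"
  have v: "v = P x *v v + w" by (simp add: w_def)
  have "P x *v w = 0"
    by (simp add: w_def matrix_vector_mult_diff_distrib P_P[OF x])
  then have "A x w = P x *v A x w"
    using A_kernel[OF x] P_N_kernel[OF x] by simp
  then have "A x (A x (A x (A x (A x w)))) = 0"
    using A_power4_fixed[OF x, of "A x w"] by simp
  then show ?thesis
    by (subst v) (simp add: A_linear A_power4_fixed[OF x])
qed

subsection \<open>The Laplacian\<close>

definition "L x = pd 1 (pd 1 P) x + pd \<i> (pd \<i> P) x"

lemma pd_pd_matrix_vector:
  assumes x: "x \<in> S" and g: "smooth_on S g"
  shows "pd h (pd h (\<lambda>y. P y *v g y)) x =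
    pd h (pd h P) x *v g x + 2 *s (pd h P x *v pd h g x) + P x *v pd h (pd h g) x"
proof -
  note B = bounded_bilinear_matrix_vector
  have "pd h (pd h (\<lambda>y. P y *v g y)) x = pd h (\<lambda>y. P y *v pd h g y + pd h P y *v g y) x"
    by (rule pd_cong_open[OF open_S x pd_bounded_bilinear[OF B diff_P smooth_on_differentiable[OF g]]])
  also have "\<dots> = pd h (\<lambda>y. P y *v pd h g y) x + pd h (\<lambda>y. pd h P y *v g y) x"
    by (rule pd_add; rule smooth_on_differentiable[OF smooth_on_bounded_bilinear[OF B open_S] x])
      (simp_all add: smooth_P g smooth_on_pd)
  also have "\<dots> = pd h (pd h P) x *v g x + 2 *s (pd h P x *v pd h g x) + P x *v pd h (pd h g) x"
    using pd_bounded_bilinear[OF B diff_P[OF x]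
        smooth_on_differentiable[OF smooth_on_pd[OF g] x], of h h]
      pd_bounded_bilinear[OF B smooth_on_differentiable[OF smooth_on_pd[OF smooth_P] x]
        smooth_on_differentiable[OF g x], of h h]
    by (simp add: vec_eq_iff)
  finally show ?thesis .
qed

text \<open>
  The twice differentiated equation \<open>P g = g\<close>, with the mixed first-order terms
  \<open>2 (P\<^sub>x g\<^sub>x + P\<^sub>y g\<^sub>y)\<close> rewritten in the Wirtinger derivatives.
\<close>
lemma L_invariant_section:
  assumes x: "x \<in> S" and g: "smooth_on S g" and fixed: "\<And>y. y \<in> S \<Longrightarrow> P y *v g y = g y"
  defines "D \<equiv> pd 1 (pd 1 g) x + pd \<i> (pd \<i> g) x"
  shows "L x *v g x = D - P x *v D - 4 *s N (- \<i>) x (wirt \<i> g x) - 4 *s N \<i> x (wirt (- \<i>) g x)"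
proof -
  have "pd h (pd h (\<lambda>y. P y *v g y)) x = pd h (pd h g) x" for h
    by (rule pd_cong_open[OF open_S x], rule pd_cong_open[OF open_S _ fixed])
  then have h: "pd h (pd h P) x *v g x = pd h (pd h g) x - P x *v pd h (pd h g) x
      - 2 *s (pd h P x *v pd h g x)" for h
    using pd_pd_matrix_vector[OF x g, of h] by (simp add: algebra_simps)
  have "4 *s N (- \<i>) x (wirt \<i> g x) + 4 *s N \<i> x (wirt (- \<i>) g x) =
      2 *s (pd 1 P x *v pd 1 g x) + 2 *s (pd \<i> P x *v pd \<i> g x)"
    by (simp add: wirt_def wirt_mat_def vector_scalar_commute matrix_vector_right_distrib
        matrix_vector_mult_diff_distrib vec_eq_iff algebra_simps)
  then show ?thesis
    unfolding L_def D_def matrix_vector_mult_add_rdistrib h matrix_vector_right_distrib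
    by (simp add: algebra_simps)
qed

lemma N_i_isotropic:
  assumes x: "x \<in> S" and "P x *v v = a *s s x"
  shows "P x *v N \<i> x v = N \<i> x v"
  using N_P[OF x, of \<i> v] assms(2) by (simp add: wirt_mat_scale N_i_s[OF x])

text \<open>
  The conjugate derivative of \<open>s\<close> is itself a section of the three-space bundle. Its derivative by
  \<open>z\<close> is a quarter of the Laplacian of \<open>s\<close>, by symmetry of second derivatives, so in the formula of
  \<open>L_invariant_section\<close> the Laplacian of \<open>s\<close> cancels against one of the two derivatives of \<open>P\<close>.
\<close>
lemma L_s:
  assumes x: "x \<in> S"
  shows "P x *v (L x *v s x) = L x *v s x"
proof -
  let ?D = "pd 1 (pd 1 s) x + pd \<i> (pd \<i> s) x"
  have pd_wirt: "pd h (wirt c s) x = (1/2) *s (pd h (pd 1 s) x + c *s pd h (pd \<i> s) x)" for h c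
  proof -
    note d = smooth_on_differentiable[OF _ x]
    note s1 = smooth_on_pd[OF smooth_s, of 1] and s2 = smooth_on_pd[OF smooth_s, of \<i>]
    note sc = smooth_on_bounded_linear[OF bounded_linear_vec_scale open_S s2, of c]
    show ?thesis
      unfolding wirt_def[abs_def]
        pd_bounded_linear[OF bounded_linear_vec_scale d[OF smooth_on_add[OF open_S s1 sc]]]
        pd_add[OF d[OF s1] d[OF sc]] pd_bounded_linear[OF bounded_linear_vec_scale d[OF s2]] ..
  qed
  have "4 *s wirt (- \<i>) (wirt \<i> s) x = ?D"
    unfolding wirt_def[of "- \<i>"] pd_wirt pd_commute[OF open_S x smooth_s, of \<i> 1]
    by (simp add: vec_eq_iff algebra_simps)
  moreover have "N (- \<i>) x (wirt \<i> s x) = wirt (- \<i>) (wirt \<i> s) x - P x *v wirt (- \<i>) (wirt \<i> s) x"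
    by (rule N_invariant_section[OF x smooth_on_wirt[OF open_S smooth_s] P_szbar])
  ultimately have "4 *s N (- \<i>) x (wirt \<i> s x) = ?D - P x *v ?D"
    by (simp add: vec.scale_right_diff_distrib flip: vector_scalar_commute)
  then have "L x *v s x = - (4 *s N \<i> x (wirt (- \<i>) s x))"
    using L_invariant_section[OF x smooth_s P_s] by simp
  moreover have "P x *v N \<i> x (wirt (- \<i>) s x) = N \<i> x (wirt (- \<i>) s x)"
    using P_sz[OF x] N_i_isotropic[OF x] by blast
  ultimately show ?thesis
    by (simp add: vec.neg vector_scalar_commute)
qed

text \<open>
  Differentiating \<open>F\<^sub>y = F \<times> F\<^sub>x\<close> by \<open>y\<close> and \<open>F\<^sub>x = - F \<times> F\<^sub>y\<close> by \<open>x\<close>, the mixed derivatives cancel and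
  \<open>2 (F \<times> F\<^sub>x) \<times> F\<^sub>x\<close> remains.
\<close>
lemma laplacian_F:
  assumes x: "x \<in> S"
  shows "pd 1 (pd 1 F) x + pd \<i> (pd \<i> F) x = (- 2 * (pd 1 F x \<bullet> pd 1 F x)) *\<^sub>R F x"
proof -
  note B = bounded_bilinear_vprod_real
  note dd = smooth_on_differentiable[OF smooth_on_pd[OF smooth_F] x]
  let ?a = "pd 1 F x" and ?b = "pd \<i> F x" and ?c = "pd 1 (pd \<i> F) x"
  have "pd \<i> (pd \<i> F) x = pd \<i> (\<lambda>y. vprod (F y) (pd 1 F y)) x"
    by (rule pd_cong_open[OF open_S x almost_complex])
  also have "\<dots> = vprod (F x) ?c + vprod ?b ?a"
    using pd_bounded_bilinear[OF B diff_F[OF x] dd, of \<i> 1]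
      pd_commute[OF open_S x smooth_F, of \<i> 1] by simp
  finally have 1: "pd \<i> (pd \<i> F) x = vprod (F x) ?c + vprod ?b ?a" .
  have "pd 1 F y = vprod (- F y) (pd \<i> F y)" if "y \<in> S" for y
    using vprod_F_pd_i[OF that] vprod_scale_left[of "- 1" "F y" "pd \<i> F y"] by simp
  then have "pd 1 (pd 1 F) x = pd 1 (\<lambda>y. vprod (- F y) (pd \<i> F y)) x"
    by (rule pd_cong_open[OF open_S x])
  also have "\<dots> = vprod (- F x) ?c + vprod (- ?a) ?b"
    using pd_bounded_bilinear[OF B differentiable_minus[OF diff_F[OF x]] dd, of 1 \<i>]
      pd_bounded_linear[OF bounded_linear_minus[OF bounded_linear_ident] diff_F[OF x], of 1] by simp
  finally have 2: "pd 1 (pd 1 F) x = vprod (- F x) ?c + vprod (- ?a) ?b" .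
  have m: "vprod (- u) v = - vprod u v" for u v :: "real^7"
    using vprod_scale_left[of "- 1" u v] by simp
  have "pd 1 (pd 1 F) x + pd \<i> (pd \<i> F) x = 2 *\<^sub>R vprod ?b ?a"
    unfolding 1 2 m vprod_swap[of ?a ?b] by (simp add: scaleR_2)
  also have "vprod ?b ?a = - (?a \<bullet> ?a) *\<^sub>R F x"
    unfolding almost_complex[OF x] vprod_vprod_right bdot_eq_inner F_pd_F[OF x]
    by (simp add: scalar_mult_eq_scaleR)
  finally show ?thesis by simp
qed

lemma L_f:
  assumes x: "x \<in> S"
  shows "P x *v (L x *v f x) = L x *v f x"
proof -
  let ?D = "pd 1 (pd 1 f) x + pd \<i> (pd \<i> f) x"
  have "pd h (pd h f) x = cvec (pd h (pd h F) x)" for h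
  proof -
    have "pd h (pd h f) x = pd h (\<lambda>y. cvec (pd h F y)) x"
      by (rule pd_cong_open[OF open_S x pd_f])
    then show ?thesis
      using pd_bounded_linear[OF bounded_linear_cvec
          smooth_on_differentiable[OF smooth_on_pd[OF smooth_F] x]] by simp
  qed
  then have "?D = cvec (pd 1 (pd 1 F) x + pd \<i> (pd \<i> F) x)"
    by (simp add: cvec_def vec_eq_iff)
  also have "\<dots> = complex_of_real (- 2 * (pd 1 F x \<bullet> pd 1 F x)) *s f x"
    unfolding laplacian_F[OF x] by (simp add: cvec_def vec_eq_iff f_def)
  finally obtain k where k: "?D = k *s f x" by blast
  have "?D - P x *v ?D = 0"
    unfolding k using P_f[OF x] by (simp add: vector_scalar_commute)
  then have L: "L x *v f x = - (4 *s N (- \<i>) x (wirt \<i> f x)) - 4 *s N \<i> x (wirt (- \<i>) f x)"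
    using L_invariant_section[OF x smooth_f P_f] by simp
  have 1: "P x *v N \<i> x (wirt (- \<i>) f x) = N \<i> x (wirt (- \<i>) f x)"
    using P_fz[OF x] N_i_isotropic[OF x] by blast
  have "N (- \<i>) x (wirt \<i> f x) = cnj_vec (N \<i> x (wirt (- \<i>) f x))"
    using x by (simp add: N_real wirt_f_real)
  then have 2: "P x *v N (- \<i>) x (wirt \<i> f x) = N (- \<i>) x (wirt \<i> f x)"
    using arg_cong[OF 1, of cnj_vec] by (simp add: P_real)
  show ?thesis
    unfolding L by (simp add: vec.neg matrix_vector_mult_diff_distrib vector_scalar_commute 1 2)
qed

lemma pd_pd_P_apply:
  assumes x: "x \<in> S"
  shows "pd h (pd h (\<lambda>y. P y *v v)) x = pd h (pd h P) x *v v"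
proof -
  have "pd h (\<lambda>y. v) = (\<lambda>y. 0)" for v :: "complex^7"
    by (simp add: fun_eq_iff)
  then show ?thesis
    using pd_pd_matrix_vector[OF x smooth_on_const, of h v] by simp
qed

lemma L_real:
  assumes x: "x \<in> S"
  shows "cnj_vec (L x *v v) = L x *v cnj_vec v"
proof -
  have "cnj_vec (pd h (pd h P) x *v v) = pd h (pd h P) x *v cnj_vec v" for h
  proof -
    have sm: "smooth_on S (\<lambda>y. P y *v v)"
      by (rule smooth_on_bounded_bilinear[OF bounded_bilinear_matrix_vector open_S smooth_P smooth_on_const])
    have "pd h (pd h (\<lambda>y. P y *v cnj_vec v)) x = pd h (pd h (\<lambda>y. cnj_vec (P y *v v))) x"
      by (simp add: P_real)
    also have "\<dots> = pd h (\<lambda>y. cnj_vec (pd h (\<lambda>y. P y *v v) y)) x"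
      by (rule pd_cong_open[OF open_S x pd_bounded_linear[OF bounded_linear_cnj_vec
            smooth_on_differentiable[OF sm]]])
    also have "\<dots> = cnj_vec (pd h (pd h (\<lambda>y. P y *v v)) x)"
      by (rule pd_bounded_linear[OF bounded_linear_cnj_vec
            smooth_on_differentiable[OF smooth_on_pd[OF sm] x]])
    finally show ?thesis by (simp add: pd_pd_P_apply[OF x])
  qed
  then show ?thesis
    by (simp add: L_def matrix_vector_mult_add_rdistrib cnj_vec_simps)
qed

lemma L_symmetric:
  assumes x: "x \<in> S"
  shows "bdot u (L x *v v) = bdot (L x *v u) v"
proof -
  note B = bounded_bilinear_bdot
  have "bdot u (pd h (pd h P) x *v v) = bdot (pd h (pd h P) x *v u) v" for h
  proof -
    have d: "(\<lambda>y. pd h P y *v w) differentiable (at x)" for w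
      by (rule smooth_on_differentiable[OF smooth_on_bounded_bilinear[OF bounded_bilinear_matrix_vector
            open_S smooth_on_pd[OF smooth_P] smooth_on_const] x])
    have e: "pd h (\<lambda>y. pd h P y *v w) x = pd h (pd h P) x *v w" for w
      using pd_bounded_bilinear[OF bounded_bilinear_matrix_vector
          smooth_on_differentiable[OF smooth_on_pd[OF smooth_P] x], where g = "\<lambda>y. w" and h = h]
      by simp
    have "pd h (\<lambda>y. bdot u (pd h P y *v v)) x = pd h (\<lambda>y. bdot (pd h P y *v u) v) x"
      by (rule pd_cong_open[OF open_S x pd_P_symmetric])
    then show ?thesis
      using pd_bounded_bilinear[OF B _ d, where f = "\<lambda>y. u" and h = h]
        pd_bounded_bilinear[OF B d, where g = "\<lambda>y. v" and h = h]
      by (simp add: e)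
  qed
  then show ?thesis
    by (simp add: L_def matrix_vector_mult_add_rdistrib bdot_simps)
qed

text \<open>The remaining frame vector is the conjugate of \<open>s\<close>, and \<open>P\<close> and \<open>L\<close> are real.\<close>
lemma L_preserves_range:
  assumes x: "x \<in> S"
  shows "P x *v (L x *v (P x *v v)) = L x *v (P x *v v)"
proof -
  obtain a b c where v: "P x *v v = a *s cnj_vec (s x) + b *s f x + c *s s x"
    using P_range[OF x] by blast
  have "P x *v (L x *v cnj_vec (s x)) = L x *v cnj_vec (s x)"
    using arg_cong[OF L_s[OF x], of cnj_vec] by (simp add: P_real L_real[OF x])
  then show ?thesis
    unfolding v by (simp add: matrix_vector_right_distrib vector_scalar_commute L_f[OF x] L_s[OF x])
qed

lemma bdot_eqI: "(\<And>w. bdot w u = bdot w v) \<Longrightarrow> u = v" for u v :: "complex^'n"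
proof -
  assume "\<And>w. bdot w u = bdot w v"
  then have "bdot (cnj_vec (u - v)) (u - v) = 0" by (simp add: bdot_diff_right)
  then have "bdot (u - v) (cnj_vec (u - v)) = 0" by (simp add: bdot_commute)
  then show "u = v" by (simp add: bdot_cnj_self)
qed

text \<open>A symmetric operator that preserves the range of the symmetric projection \<open>P\<close> commutes with \<open>P\<close>.\<close>
lemma P_L_commute:
  assumes x: "x \<in> S"
  shows "P x *v (L x *v v) = L x *v (P x *v v)"
proof (rule bdot_eqI)
  fix w
  have "bdot w (P x *v (L x *v v)) = bdot (L x *v (P x *v w)) v"
    by (simp only: P_symmetric L_symmetric[OF x])
  also have "\<dots> = bdot (P x *v (L x *v (P x *v w))) v"
    by (simp only: L_preserves_range[OF x])
  also have "\<dots> = bdot w (P x *v (L x *v (P x *v v)))"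
    by (simp only: P_symmetric L_symmetric[OF x])
  finally show "bdot w (P x *v (L x *v v)) = bdot w (L x *v (P x *v v))"
    by (simp only: L_preserves_range[OF x])
qed

subsection \<open>The reflection\<close>

lemma J_J: "x \<in> S \<Longrightarrow> J x ** J x = mat 1"
proof -
  assume x: "x \<in> S"
  have "J x *v (J x *v v) = v" for v
    by (simp add: J_apply matrix_vector_mult_diff_distrib vector_scalar_commute P_P[OF x])
      (simp add: vec_eq_iff)
  then show ?thesis by (simp add: matrix_eq matrix_vector_mul_assoc[symmetric])
qed

lemma J_eq: "J x = 2 *\<^sub>R P x + - mat 1"
  by (simp add: J_def scaleR_2)

lemma pd_J:
  assumes x: "x \<in> S"
  shows "pd h J x = 2 *\<^sub>R pd h P x"
proof -
  have d: "(\<lambda>y. 2 *\<^sub>R P y) differentiable (at x)"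
    by (rule smooth_on_differentiable[OF smooth_on_bounded_linear[OF bounded_linear_scaleR_right
          open_S smooth_P] x])
  have "pd h J x = pd h (\<lambda>y. 2 *\<^sub>R P y + - mat 1) x"
    by (rule pd_cong_open[OF open_S x J_eq])
  also have "\<dots> = 2 *\<^sub>R pd h P x"
    by (simp only: pd_add[OF d differentiable_const] pd_const add_0_right
        pd_bounded_linear[OF bounded_linear_scaleR_right diff_P[OF x]])
  finally show ?thesis .
qed

lemma smooth_J: "smooth_on S J"
proof -
  have "smooth_on S (\<lambda>y. 2 *\<^sub>R P y + - mat 1)"
    by (rule smooth_on_add[OF open_S smooth_on_bounded_linear[OF bounded_linear_scaleR_right
          open_S smooth_P] smooth_on_const])
  then show ?thesis by (simp only: J_eq[abs_def])
qed

lemma pd_pd_J: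
  assumes x: "x \<in> S"
  shows "pd h (pd h J) x = 2 *\<^sub>R pd h (pd h P) x"
proof -
  have "pd h (pd h J) x = pd h (\<lambda>y. 2 *\<^sub>R pd h P y) x"
    by (rule pd_cong_open[OF open_S x pd_J])
  then show ?thesis
    using pd_bounded_linear[OF bounded_linear_scaleR_right
        smooth_on_differentiable[OF smooth_on_pd[OF smooth_P] x]] by simp
qed

lemma J_laplacian_commute:
  assumes x: "x \<in> S"
  defines "D \<equiv> pd 1 (pd 1 J) x + pd \<i> (pd \<i> J) x"
  shows "J x ** D = D ** J x"
proof -
  have D: "D *v v = 2 *s (L x *v v)" for v
    by (simp add: D_def pd_pd_J[OF x] L_def matrix_vector_mult_add_rdistrib scaleR_matrix_vector
        scaleR_eq_scale vec.scale_right_distrib)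
  have "J x *v (D *v v) = D *v (J x *v v)" for v
    by (simp add: D J_apply vector_scalar_commute P_L_commute[OF x] matrix_vector_mult_diff_distrib
        vec.scale_right_diff_distrib)
  then show ?thesis by (simp add: matrix_eq matrix_vector_mul_assoc[symmetric])
qed

lemma J_hermitian: "cnj (J x $ i $ j) = J x $ j $ i"
proof -
  have "cnj (f x $ i) = f x $ i" for i
    by (simp add: f_def cvec_def)
  then show ?thesis
    by (simp add: J_def P_def isotropic_proj_def outer_def cnj_vec_def mat_def mult.commute add.commute)
qed

end

section \<open>Tangent vectors of the orbit\<close>

lemma inner_matrix: "inner X Y = Re (\<Sum>i\<in>UNIV. \<Sum>j\<in>UNIV. X$i$j * cnj (Y$i$j))"
  for X Y :: "complex^'n^'m"
  by (simp add: inner_vec_def inner_complex_def)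

lemma inner_hermitian_left:
  fixes X Y :: "complex^'n^'n"
  assumes "\<And>i j. cnj (J$i$j) = J$j$i"
  shows "inner (J ** X) Y = inner X (J ** Y)"
proof -
  have "(\<Sum>i\<in>UNIV. \<Sum>j\<in>UNIV. (J ** X)$i$j * cnj (Y$i$j)) =
      (\<Sum>i\<in>UNIV. \<Sum>j\<in>UNIV. \<Sum>k\<in>UNIV. J$i$k * X$k$j * cnj (Y$i$j))"
    by (simp add: matrix_matrix_mult_def sum_distrib_right)
  also have "\<dots> = (\<Sum>j\<in>UNIV. \<Sum>i\<in>UNIV. \<Sum>k\<in>UNIV. J$i$k * X$k$j * cnj (Y$i$j))"
    by (rule sum.swap)
  also have "\<dots> = (\<Sum>j\<in>UNIV. \<Sum>k\<in>UNIV. \<Sum>i\<in>UNIV. J$i$k * X$k$j * cnj (Y$i$j))"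
    by (intro sum.cong[OF refl] sum.swap)
  also have "\<dots> = (\<Sum>k\<in>UNIV. \<Sum>j\<in>UNIV. \<Sum>i\<in>UNIV. J$i$k * X$k$j * cnj (Y$i$j))"
    by (rule sum.swap)
  also have "\<dots> = (\<Sum>k\<in>UNIV. \<Sum>j\<in>UNIV. X$k$j * cnj ((J ** Y)$k$j))"
    by (simp add: matrix_matrix_mult_def sum_distrib_left assms mult_ac)
  finally show ?thesis by (simp only: inner_matrix)
qed

lemma inner_hermitian_right:
  fixes X Y :: "complex^'n^'n"
  assumes "\<And>i j. cnj (J$i$j) = J$j$i"
  shows "inner (X ** J) Y = inner X (Y ** J)"
proof -
  have "(\<Sum>i\<in>UNIV. \<Sum>j\<in>UNIV. (X ** J)$i$j * cnj (Y$i$j)) =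
      (\<Sum>i\<in>UNIV. \<Sum>j\<in>UNIV. \<Sum>k\<in>UNIV. X$i$k * J$k$j * cnj (Y$i$j))"
    by (simp add: matrix_matrix_mult_def sum_distrib_right)
  also have "\<dots> = (\<Sum>i\<in>UNIV. \<Sum>k\<in>UNIV. \<Sum>j\<in>UNIV. X$i$k * J$k$j * cnj (Y$i$j))"
    by (intro sum.cong[OF refl] sum.swap)
  also have "\<dots> = (\<Sum>i\<in>UNIV. \<Sum>k\<in>UNIV. X$i$k * cnj ((Y ** J)$i$k))"
    by (simp add: matrix_matrix_mult_def sum_distrib_left assms mult_ac)
  finally show ?thesis by (simp only: inner_matrix)
qed

text \<open>
  Conjugation by the hermitian involution \<open>J\<close> is an isometry that fixes \<open>X\<close> and negates \<open>V\<close>.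
\<close>
lemma anticommuting_orthogonal:
  fixes J X V :: "complex^'n^'n"
  assumes J: "\<And>i j. cnj (J$i$j) = J$j$i" "J ** J = mat 1"
    and X: "J ** X = X ** J" and V: "J ** V + V ** J = 0"
  shows "inner X V = 0"
proof -
  have V': "V ** J = - (J ** V)"
    using V by (simp add: eq_neg_iff_add_eq_0 add.commute)
  have minus: "J ** (- (J ** V)) = - (J ** (J ** V))"
    by (simp add: matrix_matrix_mult_def vec_eq_iff sum_negf)
  have "X = J ** (X ** J)"
    by (simp add: X[symmetric] matrix_mul_assoc J(2))
  then have "inner X V = inner (J ** (X ** J)) V" by simp
  also have "\<dots> = inner X ((J ** V) ** J)"
    by (simp only: inner_hermitian_left[OF J(1)] inner_hermitian_right[OF J(1)])
  also have "(J ** V) ** J = J ** (- (J ** V))"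
    by (simp only: V' matrix_mul_assoc[symmetric])
  also have "\<dots> = - V"
    by (simp add: minus matrix_mul_assoc J(2))
  finally show ?thesis by simp
qed

lemma matrix_inv_involution:
  fixes J :: "complex^'n^'n"
  assumes "J ** J = mat 1"
  shows "matrix_inv J = J"
proof -
  have "J ** matrix_inv J = mat 1 \<and> matrix_inv J ** J = mat 1"
    unfolding matrix_inv_def by (rule someI[of _ J]) (simp add: assms)
  then have "J ** (J ** matrix_inv J) = J" by simp
  then show ?thesis by (simp add: matrix_mul_assoc assms)
qed

lemma bounded_bilinear_matrix_mult:
  "bounded_bilinear (\<lambda>(A::complex^'n^'m) (B::complex^'k^'n). A ** B)"
  unfolding bilinear_conv_bounded_bilinear[symmetric] bilinear_def
  by (auto intro!: linearI simp: matrix_matrix_mult_def vec_eq_iff distrib_left distrib_right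
      sum.distrib scaleR_sum_right)

text \<open>
  The points of a curve in the orbit are involutions; this is the derivative of \<open>\<gamma> t ** \<gamma> t = mat 1\<close>.
\<close>
lemma tangent_vector_anticommutes:
  assumes "V \<in> tangent_vectors (iota ` G2_SO4) X"
  shows "X ** V + V ** X = 0"
proof -
  obtain \<gamma> e where e: "e > 0" and \<gamma>: "\<gamma> ` {-e<..<e} \<subseteq> iota ` G2_SO4" "\<gamma> 0 = X"
    and d: "(\<gamma> has_vector_derivative V) (at (0::real))"
    using assms unfolding tangent_vectors_def by blast
  have "((\<lambda>t. \<gamma> t ** \<gamma> t) has_vector_derivative (X ** V + V ** X)) (at 0)"
    using bounded_bilinear.has_vector_derivative[OF bounded_bilinear_matrix_mult d d] \<gamma>(2) by simp
  then have "((\<lambda>t. mat 1) has_vector_derivative (X ** V + V ** X)) (at (0::real))"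
  proof (rule has_vector_derivative_transform_within_open[where S = "{-e<..<e}"])
    show "\<gamma> t ** \<gamma> t = mat 1" if "t \<in> {-e<..<e}" for t
      using \<gamma>(1) that by (intro iota_G2_SO4_involution) blast
  qed (use e in auto)
  then show ?thesis
    using has_vector_derivative_const vector_derivative_unique_at by blast
qed

section \<open>From charts to adapted frames\<close>

lemma chart_deriv_eq_pd: "chart_deriv U z h g p = pd h (g \<circ> inv_into U z) (z p)"
  by (simp add: chart_deriv_def pd_def)

lemma hproj_hperp_line:
  assumes f: "cnj_vec f = f" "bdot f f = 1"
  shows "hproj (hperp (vec.span {f})) v = v - bdot v f *s f"
proof (rule hproj_eqI[OF subspace_hperp])
  show "v - bdot v f *s f \<in> hperp (vec.span {f})"
    by (auto simp: hperp_def hermitian_eq_bdot vec.span_singleton cnj_vec_simps f bdot_simps)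
  have "hermitian (bdot v f *s f) w = 0" if "w \<in> hperp (vec.span {f})" for w
  proof -
    have "hermitian w f = 0"
      using that vec.span_base[of f "{f}"] unfolding hperp_def by simp
    then have "hermitian f w = 0" using hermitian_cnj[of f w] by simp
    then show ?thesis by (simp add: hermitian_eq_bdot bdot_simps)
  qed
  then show "v - (v - bdot v f *s f) \<in> hperp (hperp (vec.span {f}))"
    by (simp add: hperp_def[of "hperp _"])
qed

lemma T10_S6_eigenvector: "v \<in> T10_S6 x \<Longrightarrow> vprod (cvec x) v = \<i> *s v"
  by (simp add: T10_S6_def ccross7_eq_vprod)

text \<open>The hypotheses of the theorem, shared by the two halves of its proof.\<close>
locale surface_with_line_bundle =
  fixes M :: "'m::t2_space set" and \<A> :: "'m atlas" and F :: "'m \<Rightarrow> real^7"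
    and \<alpha> \<phi> :: "'m \<Rightarrow> (complex^7) set"
  assumes surface: "riemann_surface M \<A>"
    and F: "almost_complex_map M \<A> F"
    and \<alpha>: "holomorphic_line_subbundle_T10 M \<A> F \<alpha>"
    and \<phi>: "\<And>p. p \<in> M \<Longrightarrow>
      \<phi> p = {cnj_vec a + b + c | a b c. a \<in> \<alpha> p \<and> b \<in> vec.span {cvec (F p)} \<and> c \<in> \<alpha> p}"
begin

lemma norm_F: "p \<in> M \<Longrightarrow> F p \<bullet> F p = 1"
  using F unfolding almost_complex_map_def by (simp add: norm_eq_1)

lemma section_near:
  assumes "p \<in> M"
  obtains V s where "openin (top_of_set M) V" "p \<in> V" "smooth_map_on \<A> V s"
    "\<forall>q\<in>V. s q \<noteq> 0 \<and> \<alpha> q = vec.span {s q}"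
proof -
  have "line_subbundle M \<A> \<alpha>"
    using \<alpha> by (simp add: holomorphic_line_subbundle_T10_def)
  from bspec[OF this[unfolded line_subbundle_def] assms] obtain V s where
    "openin (top_of_set M) V" "p \<in> V" "smooth_map_on \<A> V s"
    "\<forall>q\<in>V. s q \<noteq> 0 \<and> \<alpha> q = vec.span {s q}"
    by (elim exE conjE)
  then show thesis by (rule that)
qed

lemma section_facts:
  assumes "q \<in> M" "s \<noteq> 0" "\<alpha> q = vec.span {s}"
  shows "vprod (cvec (F q)) s = \<i> *s s" "\<phi> q = isotropic_span (cvec (F q)) s" "\<phi> q \<in> G2_SO4"
proof -
  have "s \<in> \<alpha> q" using assms(3) by (simp add: vec.span_base)
  then show e: "vprod (cvec (F q)) s = \<i> *s s"
    using \<alpha> assms(1) unfolding holomorphic_line_subbundle_T10_def by (blast intro: T10_S6_eigenvector)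
  show "\<phi> q = isotropic_span (cvec (F q)) s"
    by (simp only: \<phi>[OF assms(1)] assms(3) isotropic_span_eq_spans)
  then show "\<phi> q \<in> G2_SO4"
    using isotropic_span_in_G2_SO4[OF norm_F[OF assms(1)] e assms(2)] by simp
qed

lemma \<phi>_in_G2_SO4: "p \<in> M \<Longrightarrow> \<phi> p \<in> G2_SO4"
proof -
  assume p: "p \<in> M"
  obtain V s where "openin (top_of_set M) V" "p \<in> V" "smooth_map_on \<A> V s"
    "\<forall>q\<in>V. s q \<noteq> 0 \<and> \<alpha> q = vec.span {s q}"
    by (rule section_near[OF p])
  then show ?thesis using section_facts(3)[OF p, of "s p"] by simp
qed

lemma section_dbar:
  assumes "openin (top_of_set M) V" "smooth_map_on \<A> V s" "\<forall>q\<in>V. s q \<in> \<alpha> q" "(U, z) \<in> \<A>"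
  shows "\<forall>p\<in>U \<inter> V. hproj (hperp (vec.span {cvec (F p)})) (d_zbar_vec U z s p) \<in> \<alpha> p"
proof -
  have "\<forall>(U, z)\<in>\<A>. \<forall>p\<in>U \<inter> V. hproj (hperp (vec.span {cvec (F p)})) (d_zbar_vec U z s p) \<in> \<alpha> p"
    using \<alpha>[unfolded holomorphic_line_subbundle_T10_def, THEN conjunct2, THEN conjunct2,
        THEN spec, THEN spec, THEN mp, OF conjI[OF assms(1) conjI[OF assms(2,3)]]] .
  from bspec[OF this assms(4)] show ?thesis by simp
qed

text \<open>
  Around every point, the coordinate representations of \<open>F\<close> and of a nonvanishing section of \<open>\<alpha>\<close> form
  an adapted frame, and \<open>J\<close> represents \<open>\<iota>\<close>. All properties of \<open>\<phi>\<close> to be shown are local, so this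
  reduces the theorem to adapted frames.
\<close>
lemma frame_near:
  assumes Uz: "(U, z) \<in> \<A>" and p: "p \<in> U"
  obtains S s where "z p \<in> S" "S \<subseteq> z ` U" "adapted_frame S (F \<circ> inv_into U z) s"
    "\<And>x. x \<in> S \<Longrightarrow> iota (\<phi> (inv_into U z x)) = adapted_frame.J (F \<circ> inv_into U z) s x"
proof -
  let ?i = "inv_into U z"
  have U: "openin (top_of_set M) U" "open (z ` U)" and hom: "homeomorphism U (z ` U) z ?i"
    using surface Uz unfolding riemann_surface_def by auto
  have UM: "U \<subseteq> M" using U(1) openin_imp_subset by blast
  obtain V s where V: "openin (top_of_set M) V" "p \<in> V" and sm: "smooth_map_on \<A> V s"
    and s': "\<forall>q\<in>V. s q \<noteq> 0 \<and> \<alpha> q = vec.span {s q}"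
    by (rule section_near[OF subsetD[OF UM p]])
  note s = bspec[OF s']
  have VM: "V \<subseteq> M" using V(1) openin_imp_subset by blast
  let ?S = "z ` (U \<inter> V)" and ?G = "F \<circ> ?i" and ?s = "s \<circ> ?i"
  have "openin (top_of_set U) (U \<inter> V)"
    by (metis U(1) V(1) UM inf.cobounded1 openin_Int openin_subset_trans)
  then have S: "open ?S"
    using homeomorphism_imp_open_map[OF hom] U(2) openin_open_trans by blast
  have iz: "?i (z q) = q" if "q \<in> U" for q
    using hom that by (simp add: homeomorphism_def)
  have smooth_G: "smooth_on ?S ?G"
  proof -
    have "smooth_on (z ` (U \<inter> M)) ?G"
      using F Uz unfolding almost_complex_map_def smooth_map_on_def by auto
    moreover have "?S \<subseteq> z ` (U \<inter> M)" using VM by auto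
    ultimately show ?thesis unfolding smooth_on_def using Ck_on_subset by blast
  qed
  have smooth_s: "smooth_on ?S ?s"
    using sm Uz unfolding smooth_map_on_def by auto
  have frame: "adapted_frame ?S ?G ?s"
  proof
    fix x assume "x \<in> ?S"
    then obtain q where q: "q \<in> U" "q \<in> V" "x = z q" by blast
    then have qM: "q \<in> M" and ix: "?i x = q" using VM iz by auto
    note sq = s[OF q(2)]
    show "?G x \<bullet> ?G x = 1" using norm_F[OF qM] by (simp add: ix)
    have "chart_deriv U z (\<i> * 1) F q = cross7 (F q) (chart_deriv U z 1 F q)"
      using F Uz q(1) unfolding almost_complex_map_def by blast
    then show "pd \<i> ?G x = vprod (?G x) (pd 1 ?G x)"
      by (simp add: chart_deriv_eq_pd cross7_eq_vprod q(3) iz[OF q(1)])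
    show "vprod (cvec (?G x)) (?s x) = \<i> *s ?s x"
      using section_facts(1)[OF qM] sq by (simp add: ix)
    show "?s x \<noteq> 0" using sq by (simp add: ix)
    show "\<exists>a b. wirt \<i> ?s x = a *s ?s x + b *s cvec (?G x)"
    proof -
      have d: "?s differentiable (at x)"
        by (rule smooth_on_differentiable[OF smooth_s \<open>x \<in> ?S\<close>])
      have "pd h (\<lambda>y. ?s y $ i) x = pd h ?s x $ i" for h i
        by (rule pd_bounded_linear[OF bounded_linear_vec_nth d])
      then have w: "d_zbar_vec U z s q = wirt \<i> ?s x"
        by (simp add: d_zbar_vec_def d_zbar_def chart_deriv_eq_pd wirt_def vec_eq_iff q(3) o_def)
      have "s q' \<in> \<alpha> q'" if "q' \<in> V" for q'
        using s[OF that] by (simp add: vec.span_base)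
      then have "hproj (hperp (vec.span {cvec (F q)})) (d_zbar_vec U z s q) \<in> \<alpha> q"
        using section_dbar[OF V(1) sm _ Uz] q(1,2) by blast
      moreover have "bdot (cvec (F q)) (cvec (F q)) = 1"
        by (simp add: bdot_cvec norm_F[OF qM])
      ultimately have "wirt \<i> ?s x - bdot (wirt \<i> ?s x) (cvec (F q)) *s cvec (F q) \<in> vec.span {s q}"
        using sq by (simp add: hproj_hperp_line w)
      then obtain a where "wirt \<i> ?s x - bdot (wirt \<i> ?s x) (cvec (F q)) *s cvec (F q) = a *s s q"
        by (auto simp: vec.span_singleton)
      then have "wirt \<i> ?s x = a *s ?s x + bdot (wirt \<i> ?s x) (cvec (F q)) *s cvec (?G x)"
        by (simp add: ix algebra_simps)
      then show ?thesis by blast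
    qed
  qed (use S smooth_G smooth_s in auto)
  have iota: "iota (\<phi> (?i x)) = adapted_frame.J ?G ?s x" if x: "x \<in> ?S" for x
  proof -
    interpret adapted_frame ?S ?G ?s by (rule frame)
    obtain q where q: "q \<in> U" "q \<in> V" "x = z q" using x by blast
    have eq: "\<phi> (?i x) = isotropic_span (f x) (?s x)"
      using section_facts(2)[of q "s q"] s[OF q(2)] VM q by (auto simp: f_def iz)
    show ?thesis
      unfolding J_def eq by (rule iota_eq[OF subspace_isotropic_span orthoproj_P[OF x]])
  qed
  have "z p \<in> ?S" "?S \<subseteq> z ` U" using p V(2) by auto
  then show thesis using frame iota by (rule that)
qed

lemma smooth_iota: "smooth_map_on \<A> M (\<lambda>p. iota (\<phi> p))"
  unfolding smooth_map_on_def
proof (clarify)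
  fix U z assume Uz: "(U, z) \<in> \<A>"
  let ?g = "(\<lambda>p. iota (\<phi> p)) \<circ> inv_into U z"
  have "Ck_on k (z ` (U \<inter> M)) ?g" for k
  proof (rule Ck_on_local)
    fix x assume "x \<in> z ` (U \<inter> M)"
    then obtain p where "p \<in> U" "x = z p" by blast
    with frame_near[OF Uz] obtain S s where S: "x \<in> S" "adapted_frame S (F \<circ> inv_into U z) s"
      "\<And>x. x \<in> S \<Longrightarrow> iota (\<phi> (inv_into U z x)) = adapted_frame.J (F \<circ> inv_into U z) s x"
      by metis
    interpret adapted_frame S "F \<circ> inv_into U z" s by fact
    have "Ck_on k S ?g"
      by (rule Ck_on_cong[OF open_S _ smooth_J[unfolded smooth_on_def, rule_format]])
        (simp add: S(3))
    then show "\<exists>T. open T \<and> x \<in> T \<and> Ck_on k T ?g"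
      using open_S S(1) by blast
  qed
  then show "smooth_on (z ` (U \<inter> M)) ?g" by (simp add: smooth_on_def)
qed

lemma harmonic: "harmonic_map_G2_SO4 M \<A> \<phi>"
  unfolding harmonic_map_G2_SO4_def harmonic_map_def
proof (intro conjI ballI smooth_iota \<phi>_in_G2_SO4 imageI; clarify)
  fix U z p V
  assume Uz: "(U, z) \<in> \<A>" and p: "p \<in> U" and V: "V \<in> tangent_vectors (iota ` G2_SO4) (iota (\<phi> p))"
  let ?i = "inv_into U z" and ?u = "\<lambda>p. iota (\<phi> p)"
  obtain S s where S: "z p \<in> S" "S \<subseteq> z ` U" "adapted_frame S (F \<circ> ?i) s"
    "\<And>x. x \<in> S \<Longrightarrow> iota (\<phi> (?i x)) = adapted_frame.J (F \<circ> ?i) s x"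
    using frame_near[OF Uz p] by blast
  interpret adapted_frame S "F \<circ> ?i" s by fact
  have zi: "z (?i x) = x" if "x \<in> S" for x
    using that S(2) by (auto intro: f_inv_into_f)
  have ip: "?i (z p) = p"
    using surface Uz p unfolding riemann_surface_def homeomorphism_def by auto
  have 1: "pd h (?u \<circ> ?i) x = pd h J x" if "x \<in> S" for h x
    by (rule pd_cong_open[OF open_S that]) (simp add: S(4))
  have "chart_deriv U z h (chart_deriv U z h ?u) p = pd h (pd h J) (z p)" for h
    unfolding chart_deriv_eq_pd[of U z h "chart_deriv U z h ?u"]
    by (rule pd_cong_open[OF open_S S(1)]) (simp add: chart_deriv_eq_pd zi 1)
  then have "chart_laplacian U z ?u p = pd 1 (pd 1 J) (z p) + pd \<i> (pd \<i> J) (z p)"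
    by (simp add: chart_laplacian_def)
  moreover have "J (z p) ** V + V ** J (z p) = 0"
    using tangent_vector_anticommutes[OF V] S(4)[OF S(1)] ip by simp
  ultimately show "chart_laplacian U z ?u p \<bullet> V = 0"
    using anticommuting_orthogonal[OF J_hermitian J_J[OF S(1)] J_laplacian_commute[OF S(1)]] by simp
qed

lemma nilconformal: "nilconformal \<A> \<phi>"
  unfolding nilconformal_def
proof (clarify)
  fix U z assume Uz: "(U, z) \<in> \<A>"
  let ?i = "inv_into U z" and ?u = "\<lambda>p. iota (\<phi> p)"
  have "((\<lambda>B. A_z U z \<phi> p ** B) ^^ 5) (mat 1) = 0" if p: "p \<in> U" for p
  proof -
    obtain S s where S: "z p \<in> S" "S \<subseteq> z ` U" "adapted_frame S (F \<circ> ?i) s"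
      "\<And>x. x \<in> S \<Longrightarrow> iota (\<phi> (?i x)) = adapted_frame.J (F \<circ> ?i) s x"
      using frame_near[OF Uz p] by blast
    interpret adapted_frame S "F \<circ> ?i" s by fact
    have ip: "?i (z p) = p"
      using surface Uz p unfolding riemann_surface_def homeomorphism_def by auto
    have up: "?u p = J (z p)" using S(4)[OF S(1)] ip by simp
    have inv: "matrix_inv (?u p) = J (z p)"
      unfolding up by (rule matrix_inv_involution[OF J_J[OF S(1)]])
    have "pd h (\<lambda>x. ?u (?i x) $ i $ j) (z p) = 2 * pd h P (z p) $ i $ j" for h i j
    proof -
      have "pd h (\<lambda>x. ?u (?i x) $ i $ j) (z p) = pd h (\<lambda>x. J x $ i $ j) (z p)"
        by (rule pd_cong_open[OF open_S S(1)]) (simp add: S(4))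
      also have "\<dots> = pd h J (z p) $ i $ j"
        by (rule pd_bounded_linear[OF bounded_linear_compose[OF bounded_linear_vec_nth
                bounded_linear_vec_nth] smooth_on_differentiable[OF smooth_J S(1)]])
      finally show ?thesis by (simp add: pd_J[OF S(1)] scaleR_conv_of_real)
    qed
    then have "d_z_mat U z ?u p $ i $ j = pd 1 P (z p) $ i $ j - \<i> * pd \<i> P (z p) $ i $ j" for i j
      by (simp add: d_z_mat_def d_z_def chart_deriv_eq_pd o_def)
    then have "d_z_mat U z ?u p *v w = 2 *s N (- \<i>) (z p) w" for w
      by (simp add: wirt_mat_def vec_eq_iff matrix_vector_mult_def left_diff_distrib sum_subtractf
          sum_distrib_left mult.assoc)
    then have A: "A_z U z \<phi> p *v w = A (z p) w" for w
      unfolding A_z_def inv A_def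
      by (simp add: scaleR_matrix_vector matrix_vector_mul_assoc[symmetric] vector_scalar_commute
          scaleR_eq_scale)
    show ?thesis
      by (simp add: eval_nat_numeral matrix_eq matrix_vector_mul_assoc[symmetric] A
          A_nilpotent[OF S(1)])
  qed
  then show "\<exists>r::nat. \<forall>p\<in>U. ((\<lambda>B. A_z U z \<phi> p ** B) ^^ r) (mat 1) = 0" by blast
qed

end

theorem proposition5p5:
  fixes M :: "'m::t2_space set" and \<A> :: "'m atlas"
    and F :: "'m \<Rightarrow> real^7"
    and \<alpha> \<phi> :: "'m \<Rightarrow> (complex^7) set"
  assumes "riemann_surface M \<A>"
    and "almost_complex_map M \<A> F"
    and "holomorphic_line_subbundle_T10 M \<A> F \<alpha>"
    and "\<And>p. p \<in> M \<Longrightarrow>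
      \<phi> p = {cnj_vec a + b + c | a b c. a \<in> \<alpha> p \<and> b \<in> vec.span {cvec (F p)} \<and> c \<in> \<alpha> p}"
  shows "harmonic_map_G2_SO4 M \<A> \<phi> \<and> nilconformal \<A> \<phi>"
proof -
  interpret surface_with_line_bundle M \<A> F \<alpha> \<phi>
    using assms by unfold_locales
  show ?thesis using harmonic nilconformal by simp
qed

end
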